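(* Let $\mathfrak g$ be a complex Lie superalgebra and $\mathfrak k\subseteq\mathfrak g$ a subalgebra. Then the superspace $\mathcal A(\mathfrak g,\mathfrak k)$ is a subalgebra of $U(\mathfrak g)^*$.
   Context: The base field is $\mathbb C$. $U(\mathfrak g)$ is the universal enveloping algebra, a Hopf superalgebra with coproduct $\Delta(x)=1\otimes x+x\otimes 1$ for $x\in\mathfrak g$. The dual $U(\mathfrak g)^*$ is an associative algebra with product $\phi\psi(x)=\sum(-1)^{|x_1||\psi|}\phi(x_1)\psi(x_2)$, where $\Delta(x)=\sum x_1\otimes x_2$ and $|\cdot|$ denotes parity. Subalgebras of Lie superalgebras are $\mathbb Z_2$-graded. Put $\mathcal I:=\mathfrak kU(\mathfrak g)+U(\mathfrak g)\mathfrak k$. An element $\lambda\in U(\mathfrak g)^*$ is called $\mathfrak k$-bi-invariant if $\mathcal I\subseteq\ker\lambda$, and $\mathcal A(\mathfrak g,\mathfrak k)$ is the ($\mathbb Z_2$-graded) subspace of all $\mathfrak k$-bi-invariant elements of $U(\mathfrak g)^*$. *)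

theory Defs
  imports Complex_Main "HOL-Library.Poly_Mapping" "HOL-Library.Z2"
begin

section \<open>Complex vector spaces and algebras\<close>

class complex_vector = ab_group_add +
  fixes scaleC :: "complex \<Rightarrow> 'a \<Rightarrow> 'a"  (infixr \<open>*\<^sub>C\<close> 75)
  assumes scaleC_add_right: "a *\<^sub>C (x + y) = a *\<^sub>C x + a *\<^sub>C y"
    and scaleC_add_left: "(a + b) *\<^sub>C x = a *\<^sub>C x + b *\<^sub>C x"
    and scaleC_scaleC: "a *\<^sub>C b *\<^sub>C x = (a * b) *\<^sub>C x"
    and scaleC_one: "1 *\<^sub>C x = x"

global_interpretation complex_vector: vector_space "scaleC :: complex \<Rightarrow> 'a \<Rightarrow> 'a::complex_vector"
  by unfold_locales (simp_all add: scaleC_add_right scaleC_add_left scaleC_scaleC scaleC_one)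

declare scaleC_scaleC [simp] scaleC_one [simp]
lemmas scaleC_distribs = scaleC_add_right scaleC_add_left
  complex_vector.scale_left_diff_distrib complex_vector.scale_right_diff_distrib
  complex_vector.scale_sum_right

abbreviation csubspace :: "'a::complex_vector set \<Rightarrow> bool"
  where "csubspace \<equiv> module.subspace scaleC"

abbreviation cspan :: "'a::complex_vector set \<Rightarrow> 'a set"
  where "cspan \<equiv> module.span scaleC"

abbreviation clinear :: "('a::complex_vector \<Rightarrow> 'b::complex_vector) \<Rightarrow> bool"
  where "clinear \<equiv> Vector_Spaces.linear scaleC scaleC"

definition cbilinear :: "('a::complex_vector \<Rightarrow> 'b::complex_vector \<Rightarrow> 'c::complex_vector) \<Rightarrow> bool"
  where "cbilinear f \<longleftrightarrow> (\<forall>x. clinear (f x)) \<and> (\<forall>y. clinear (\<lambda>x. f x y))"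

lemma clinear_iff:
  "clinear f \<longleftrightarrow> (\<forall>x y. f (x + y) = f x + f y) \<and> (\<forall>c x. f (c *\<^sub>C x) = c *\<^sub>C f x)"
  by (simp add: Vector_Spaces.linear_iff complex_vector.vector_space_axioms)

lemma clinearI:
  "(\<And>x y. f (x + y) = f x + f y) \<Longrightarrow> (\<And>c x. f (c *\<^sub>C x) = c *\<^sub>C f x) \<Longrightarrow> clinear f"
  by (simp add: clinear_iff)

lemma clinear_add: "clinear f \<Longrightarrow> f (x + y) = f x + f y"
  and clinear_scale: "clinear f \<Longrightarrow> f (c *\<^sub>C x) = c *\<^sub>C f x"
  by (simp_all add: clinear_iff)

lemma clinear_0: "clinear f \<Longrightarrow> f 0 = 0"
  using clinear_scale[of f 0 0] by simp

lemma clinear_minus: "clinear f \<Longrightarrow> f (- x) = - f x"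
  using clinear_scale[of f "-1" x] by simp

lemma clinear_diff: "clinear f \<Longrightarrow> f (x - y) = f x - f y"
  using clinear_add[of f x "- y"] clinear_minus[of f y] by simp

lemma clinear_sum: "clinear f \<Longrightarrow> f (sum g A) = (\<Sum>a\<in>A. f (g a))"
  by (induction A rule: infinite_finite_induct) (simp_all add: clinear_0 clinear_add)

lemma clinear_id: "clinear (\<lambda>x. x)"
  by (simp add: clinear_iff)

lemma clinear_compose: "clinear f \<Longrightarrow> clinear g \<Longrightarrow> clinear (\<lambda>x. f (g x))"
  by (simp add: clinear_iff)

lemma clinear_plus: "clinear f \<Longrightarrow> clinear g \<Longrightarrow> clinear (\<lambda>x. f x + g x)"
  by (simp add: clinear_iff algebra_simps scaleC_distribs)

lemma clinear_minus2: "clinear f \<Longrightarrow> clinear g \<Longrightarrow> clinear (\<lambda>x. f x - g x)"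
  by (simp add: clinear_iff algebra_simps scaleC_distribs)

lemma clinear_scaleC: "clinear f \<Longrightarrow> clinear (\<lambda>x. c *\<^sub>C f x)"
  by (simp add: clinear_iff algebra_simps scaleC_distribs)

lemma clinear_zero: "clinear (\<lambda>x. 0)"
  by (simp add: clinear_iff)

lemma clinear_sumf: "(\<And>i. i \<in> A \<Longrightarrow> clinear (f i)) \<Longrightarrow> clinear (\<lambda>x. \<Sum>i\<in>A. f i x)"
  by (induction A rule: infinite_finite_induct) (simp_all add: clinear_zero clinear_plus)

lemmas csubspace_def = complex_vector.subspace_def

lemma csubspace_ker: "clinear f \<Longrightarrow> csubspace {x. f x = 0}"
  by (auto simp: csubspace_def clinear_0 clinear_add clinear_scale)

lemma csubspace_eq: "clinear f \<Longrightarrow> clinear g \<Longrightarrow> csubspace {x. f x = g x}"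
  by (auto simp: csubspace_def clinear_0 clinear_add clinear_scale)

class complex_algebra_1 = complex_vector + ring_1 +
  assumes scaleC_mult_left: "(c *\<^sub>C x) * y = c *\<^sub>C (x * y)"
    and scaleC_mult_right: "x * (c *\<^sub>C y) = c *\<^sub>C (x * y)"

lemma clinear_mult_left: "clinear f \<Longrightarrow> clinear (\<lambda>x. (a::'a::complex_algebra_1) * f x)"
  and clinear_mult_right: "clinear f \<Longrightarrow> clinear (\<lambda>x. f x * (a::'a::complex_algebra_1))"
  by (simp_all add: clinear_iff algebra_simps scaleC_mult_left scaleC_mult_right)

instantiation complex :: complex_algebra_1
begin
definition scaleC_complex :: "complex \<Rightarrow> complex \<Rightarrow> complex"
  where "c *\<^sub>C d = c * d"
instance by standard (simp_all add: scaleC_complex_def algebra_simps)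
end

declare scaleC_complex_def [simp]

definition subalgebra :: "'a::complex_algebra_1 set \<Rightarrow> bool"
  where "subalgebra S \<longleftrightarrow> csubspace S \<and> 1 \<in> S \<and> (\<forall>a\<in>S. \<forall>b\<in>S. a * b \<in> S)"

section \<open>Superspaces and superalgebras\<close>

text \<open>The type \<open>bit\<close> is the field with two elements; it indexes the \<open>\<int>\<^sub>2\<close>-grading.\<close>

class superspace = complex_vector +
  fixes grade :: "bit \<Rightarrow> 'a set"
  assumes grade_0 [simp]: "0 \<in> grade i"
    and grade_add: "x \<in> grade i \<Longrightarrow> y \<in> grade i \<Longrightarrow> x + y \<in> grade i"
    and grade_scaleC: "x \<in> grade i \<Longrightarrow> c *\<^sub>C x \<in> grade i"
    and grade_inter: "grade 0 \<inter> grade 1 = {0}"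
    and grade_sum: "\<exists>y\<in>grade 0. \<exists>z\<in>grade 1. x = y + z"

definition hcomp :: "bit \<Rightarrow> 'a::superspace \<Rightarrow> 'a"  \<comment> \<open>homogeneous component\<close>
  where "hcomp i x = (THE y. y \<in> grade i \<and> x - y \<in> grade (i + 1))"

definition graded_subspace :: "'a::superspace set \<Rightarrow> bool"
  where "graded_subspace S \<longleftrightarrow> csubspace S \<and> (\<forall>x\<in>S. \<forall>i. hcomp i x \<in> S)"

text \<open>The Koszul sign \<open>(-1)\<^sup>i\<^sup>j\<close>.\<close>

definition koszul :: "bit \<Rightarrow> bit \<Rightarrow> complex"
  where "koszul i j = (if i = 1 \<and> j = 1 then - 1 else 1)"

class superalgebra = complex_algebra_1 + superspace +
  assumes grade_one: "1 \<in> grade 0"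
    and grade_mult: "a \<in> grade i \<Longrightarrow> b \<in> grade j \<Longrightarrow> a * b \<in> grade (i + j)"

lemma bit_add_simps [simp]: "(i::bit) + i = 0" "i + (i + j) = j"
  by (cases i; cases j; simp)+

declare add_bit_eq_xor [simp del] mult_bit_eq_and [simp del]

lemma all_bit: "(\<forall>i::bit. P i) \<longleftrightarrow> P 0 \<and> P 1"
  by (metis bit.exhaust)

lemma grade_subspace: "csubspace (grade i)"
  by (simp add: csubspace_def grade_add grade_scaleC)

lemma grade_diff: "x \<in> grade i \<Longrightarrow> y \<in> grade i \<Longrightarrow> x - y \<in> grade i"
  using complex_vector.subspace_diff[OF grade_subspace] .

lemma hcomp_unique:
  assumes "y \<in> grade i" "x - y \<in> grade (i + 1)" shows "hcomp i x = y"
  unfolding hcomp_def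
proof (rule the_equality)
  fix y' assume a: "y' \<in> grade i \<and> x - y' \<in> grade (i + 1)"
  have "y' - y \<in> grade i" using a assms grade_diff by blast
  moreover have "y' - y \<in> grade (i + 1)"
    using grade_diff[of "x - y" "i+1" "x - y'"] a assms by simp
  ultimately have "y' - y \<in> grade 0 \<inter> grade 1" by (cases i) auto
  then show "y' = y" by (simp add: grade_inter)
qed (use assms in simp)

lemma hcomp_ex: "\<exists>y. y \<in> grade i \<and> x - y \<in> grade (i + 1)"
proof -
  obtain y z where "y \<in> grade 0" "z \<in> grade 1" "x = y + z" using grade_sum by blast
  then show ?thesis by (cases i) (auto intro: exI[of _ y] exI[of _ z])
qed

lemma hcomp_grade [simp]: "hcomp i x \<in> grade i"
  and hcomp_compl: "x - hcomp i x \<in> grade (i + 1)"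
  using hcomp_ex[of i x] hcomp_unique[of _ i x] by auto

lemma hcomp_sum: "hcomp 0 x + hcomp 1 x = x"
  using hcomp_unique[of "x - hcomp 0 x" 1 x] hcomp_compl[of x 0] hcomp_grade[of 0 x] by simp

lemma hcomp_same: "x \<in> grade i \<Longrightarrow> hcomp i x = x"
  by (rule hcomp_unique) auto

lemma hcomp_other: "x \<in> grade j \<Longrightarrow> i \<noteq> j \<Longrightarrow> hcomp i x = 0"
  using hcomp_unique[of 0 i x] by (cases i; cases j) auto

lemma clinear_hcomp: "clinear (hcomp i)"
proof (rule clinearI)
  fix x y :: 'a and c
  show "hcomp i (x + y) = hcomp i x + hcomp i y"
    using grade_add[OF hcomp_compl hcomp_compl, of x i y]
    by (intro hcomp_unique) (auto intro: grade_add simp: algebra_simps)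
  show "hcomp i (c *\<^sub>C x) = c *\<^sub>C hcomp i x"
    using grade_scaleC[OF hcomp_compl, of c x i]
    by (intro hcomp_unique) (auto intro: grade_scaleC simp: scaleC_distribs)
qed

lemmas hcomp_add [simp] = clinear_add[OF clinear_hcomp]
  and hcomp_scaleC [simp] = clinear_scale[OF clinear_hcomp]
  and hcomp_0 [simp] = clinear_0[OF clinear_hcomp]

lemma koszul_simps [simp]: "koszul 0 j = 1" "koszul i 0 = 1" "koszul 1 1 = -1"
  by (simp_all add: koszul_def)

section \<open>Lie superalgebras\<close>

class lie_superalgebra = superspace +
  fixes sbracket :: "'a \<Rightarrow> 'a \<Rightarrow> 'a"
  assumes sbracket_add_left: "sbracket (x + y) z = sbracket x z + sbracket y z"
    and sbracket_add_right: "sbracket z (x + y) = sbracket z x + sbracket z y"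
    and sbracket_scaleC_left: "sbracket (c *\<^sub>C x) y = c *\<^sub>C sbracket x y"
    and sbracket_scaleC_right: "sbracket x (c *\<^sub>C y) = c *\<^sub>C sbracket x y"
    and sbracket_grade: "x \<in> grade i \<Longrightarrow> y \<in> grade j \<Longrightarrow> sbracket x y \<in> grade (i + j)"
    and sbracket_skew: "x \<in> grade i \<Longrightarrow> y \<in> grade j \<Longrightarrow>
      sbracket x y = - (koszul i j *\<^sub>C sbracket y x)"
    and sbracket_jacobi: "x \<in> grade i \<Longrightarrow> y \<in> grade j \<Longrightarrow> z \<in> grade l \<Longrightarrow>
      sbracket x (sbracket y z) =
        sbracket (sbracket x y) z + koszul i j *\<^sub>C sbracket y (sbracket x z)"

definition lie_subsuperalgebra :: "'g::lie_superalgebra set \<Rightarrow> bool"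
  where "lie_subsuperalgebra k \<longleftrightarrow>
    graded_subspace k \<and> (\<forall>x\<in>k. \<forall>y\<in>k. sbracket x y \<in> k)"

section \<open>Free vector spaces and free algebras\<close>

instantiation poly_mapping :: (type, complex_vector) complex_vector
begin
definition scaleC_poly_mapping :: "complex \<Rightarrow> ('a \<Rightarrow>\<^sub>0 'b) \<Rightarrow> ('a \<Rightarrow>\<^sub>0 'b)"
  where "c *\<^sub>C p = Poly_Mapping.map (scaleC c) p"

lemma lookup_scaleC: "Poly_Mapping.lookup (c *\<^sub>C p) k = c *\<^sub>C Poly_Mapping.lookup p k"
  by (simp add: scaleC_poly_mapping_def map.rep_eq when_def)

instance
  by standard (auto intro!: poly_mapping_eqI simp: lookup_scaleC lookup_add scaleC_distribs)
end

text \<open>With concatenation of words as addition, the convolution product of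
  \<open>'g list \<Rightarrow>\<^sub>0 complex\<close> is that of the free associative algebra on the set \<open>'g\<close>.\<close>

instantiation list :: (type) monoid_add
begin
definition zero_list :: "'a list" where "0 = []"
definition plus_list :: "'a list \<Rightarrow> 'a list \<Rightarrow> 'a list" where "u + v = u @ v"
instance by standard (simp_all add: zero_list_def plus_list_def)
end

text \<open>The linear extension of \<open>f\<close> to the free vector space.\<close>

definition lin_ext :: "('a \<Rightarrow> 'v::complex_vector) \<Rightarrow> ('a \<Rightarrow>\<^sub>0 complex) \<Rightarrow> 'v"
  where "lin_ext f p = (\<Sum>x\<in>Poly_Mapping.keys p. Poly_Mapping.lookup p x *\<^sub>C f x)"

lemma lin_ext_superset:
  "finite A \<Longrightarrow> Poly_Mapping.keys p \<subseteq> A \<Longrightarrow> lin_ext f p = (\<Sum>x\<in>A. Poly_Mapping.lookup p x *\<^sub>C f x)"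
  unfolding lin_ext_def by (rule sum.mono_neutral_left) (auto simp: in_keys_iff)

lemma clinear_lin_ext: "clinear (lin_ext f)"
proof (rule clinearI)
  fix p q :: "'a \<Rightarrow>\<^sub>0 complex" and c
  let ?A = "Poly_Mapping.keys p \<union> Poly_Mapping.keys q"
  have "Poly_Mapping.keys (p + q) \<subseteq> ?A" by (rule Poly_Mapping.keys_add)
  then show "lin_ext f (p + q) = lin_ext f p + lin_ext f q"
    by (simp add: lin_ext_superset[of ?A] lookup_add scaleC_distribs sum.distrib)
  have "Poly_Mapping.keys (c *\<^sub>C p) \<subseteq> Poly_Mapping.keys p"
    by (auto simp: in_keys_iff lookup_scaleC)
  then show "lin_ext f (c *\<^sub>C p) = c *\<^sub>C lin_ext f p"
    by (simp add: lin_ext_superset[of "Poly_Mapping.keys p"] lookup_scaleC scaleC_distribs)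
qed

lemma lin_ext_single [simp]: "lin_ext f (Poly_Mapping.single x c) = c *\<^sub>C f x"
  by (simp add: lin_ext_def)

lemma scaleC_single: "c *\<^sub>C Poly_Mapping.single x d = Poly_Mapping.single x (c * d :: complex)"
  by (rule poly_mapping_eqI) (auto simp: lookup_scaleC lookup_single when_def)

lemma poly_mapping_induct [case_names single add]:
  fixes p :: "'a \<Rightarrow>\<^sub>0 'b::comm_monoid_add"
  assumes "\<And>x c. P (Poly_Mapping.single x c)" "\<And>p q. P p \<Longrightarrow> P q \<Longrightarrow> P (p + q)"
  shows "P p"
proof (rule update_induct)
  show "P 0" using assms(1)[of undefined 0] by simp
next
  fix q :: "'a \<Rightarrow>\<^sub>0 'b" and a b
  assume "a \<notin> Poly_Mapping.keys q" "P q"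
  moreover from this have "Poly_Mapping.update a b q = q + Poly_Mapping.single a b"
    by (intro poly_mapping_eqI)
      (auto simp: lookup_update lookup_add lookup_single when_def in_keys_iff)
  ultimately show "P (Poly_Mapping.update a b q)" using assms by simp
qed

lemma lin_ext_mult:
  fixes f :: "'g list \<Rightarrow> 'a::complex_algebra_1"
  assumes "\<And>u v. f (u @ v) = f u * f v"
  shows "lin_ext f (p * q) = lin_ext f p * lin_ext f q"
proof (induction p rule: poly_mapping_induct)
  case (single x c)
  show ?case
    by (induction q rule: poly_mapping_induct)
      (simp_all add: mult_single plus_list_def assms scaleC_mult_left scaleC_mult_right
        distrib_left clinear_add[OF clinear_lin_ext])
qed (simp add: distrib_right clinear_add[OF clinear_lin_ext])

section \<open>The universal enveloping algebra\<close>

inductive_set two_sided_ideal :: "'a::ring_1 set \<Rightarrow> 'a set" for R :: "'a set" where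
  zero: "0 \<in> two_sided_ideal R"
| base: "r \<in> R \<Longrightarrow> r \<in> two_sided_ideal R"
| add: "a \<in> two_sided_ideal R \<Longrightarrow> b \<in> two_sided_ideal R \<Longrightarrow> a + b \<in> two_sided_ideal R"
| mult_left: "a \<in> two_sided_ideal R \<Longrightarrow> x * a \<in> two_sided_ideal R"
| mult_right: "a \<in> two_sided_ideal R \<Longrightarrow> a * x \<in> two_sided_ideal R"

lemma two_sided_ideal_minus: "a \<in> two_sided_ideal R \<Longrightarrow> - a \<in> two_sided_ideal R"
  using two_sided_ideal.mult_left[of a R "-1"] by simp

lemma two_sided_ideal_diff:
  "a \<in> two_sided_ideal R \<Longrightarrow> b \<in> two_sided_ideal R \<Longrightarrow> a - b \<in> two_sided_ideal R"
  using two_sided_ideal.add[OF _ two_sided_ideal_minus] by fastforce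

definition free_gen :: "'g \<Rightarrow> 'g list \<Rightarrow>\<^sub>0 complex"
  where "free_gen x = Poly_Mapping.single [x] 1"

text \<open>The first two families of relations turn the free algebra on the set \<open>'g\<close> into the
  tensor algebra of the vector space \<open>'g\<close>.\<close>

definition uea_relations :: "('g::lie_superalgebra list \<Rightarrow>\<^sub>0 complex) set"
  where "uea_relations =
    {free_gen (x + y) - free_gen x - free_gen y | x y. True} \<union>
    {free_gen (c *\<^sub>C x) - c *\<^sub>C free_gen x | c x. True} \<union>
    {free_gen x * free_gen y - koszul i j *\<^sub>C (free_gen y * free_gen x) - free_gen (sbracket x y)
      | x y i j. x \<in> grade i \<and> y \<in> grade j}"

definition uea_rel :: "('g::lie_superalgebra list \<Rightarrow>\<^sub>0 complex) \<Rightarrow> ('g list \<Rightarrow>\<^sub>0 complex) \<Rightarrow> bool"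
  where "uea_rel p q \<longleftrightarrow> p - q \<in> two_sided_ideal uea_relations"

lemma uea_rel_equivp: "equivp uea_rel"
proof -
  have "x - z \<in> two_sided_ideal R"
    if "x - y \<in> two_sided_ideal R" "y - z \<in> two_sided_ideal R" for x y z :: "'b::ring_1" and R
    using two_sided_ideal.add[OF that] by simp
  moreover have "y - x \<in> two_sided_ideal R"
    if "x - y \<in> two_sided_ideal R" for x y :: "'b::ring_1" and R
    using two_sided_ideal_minus[OF that] by simp
  ultimately show ?thesis
    unfolding equivp_reflp_symp_transp reflp_def symp_def transp_def uea_rel_def
    by (simp add: two_sided_ideal.zero) blast
qed

quotient_type (overloaded) 'g uea = "'g::lie_superalgebra list \<Rightarrow>\<^sub>0 complex" / uea_rel
  by (rule uea_rel_equivp)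

lemma scaleC_poly_mapping_mult:
  "c *\<^sub>C p = Poly_Mapping.single 0 c * (p :: 'g list \<Rightarrow>\<^sub>0 complex)"
proof -
  have "scaleC c = (*) c" by (rule ext) simp
  then show ?thesis by (simp add: scaleC_poly_mapping_def flip: mult_map_scale_conv_mult)
qed

lemma scaleC_poly_mapping_mult_right:
  "c *\<^sub>C p = (p :: 'g list \<Rightarrow>\<^sub>0 complex) * Poly_Mapping.single 0 c"
proof (induction p rule: poly_mapping_induct)
  case (single x d)
  then show ?case by (simp add: scaleC_single mult_single mult.commute)
next
  case (add p q)
  then show ?case by (simp add: scaleC_distribs distrib_right)
qed

text \<open>Maps \<open>f\<close> that extend (uniquely) to an algebra homomorphism on the universal enveloping
  algebra.\<close>

definition enveloping :: "('g::lie_superalgebra \<Rightarrow> 'a::complex_algebra_1) \<Rightarrow> bool"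
  where "enveloping f \<longleftrightarrow> clinear f \<and>
    (\<forall>i j. \<forall>x\<in>grade i. \<forall>y\<in>grade j.
      f x * f y - koszul i j *\<^sub>C (f y * f x) = f (sbracket x y))"

definition word_ext :: "('g \<Rightarrow> 'a::complex_algebra_1) \<Rightarrow> ('g list \<Rightarrow>\<^sub>0 complex) \<Rightarrow> 'a"
  where "word_ext f = lin_ext (\<lambda>w. prod_list (map f w))"

lemma clinear_word_ext: "clinear (word_ext f)"
  unfolding word_ext_def by (rule clinear_lin_ext)

lemma word_ext_mult: "word_ext f (p * q) = word_ext f p * word_ext f q"
  unfolding word_ext_def by (rule lin_ext_mult) simp

lemma word_ext_gen: "word_ext f (free_gen x) = f x"
  by (simp add: word_ext_def free_gen_def)

lemma word_ext_1: "word_ext f 1 = 1"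
  unfolding word_ext_def using lin_ext_single[of _ "[]" 1]
  by (simp add: zero_list_def flip: single_one)

lemma word_ext_ideal:
  assumes "enveloping f" "p \<in> two_sided_ideal uea_relations"
  shows "word_ext f p = 0"
  using assms(2)
proof induction
  case (base r)
  note lin = clinear_diff[OF clinear_word_ext] clinear_scale[OF clinear_word_ext]
    word_ext_mult word_ext_gen
  have f: "clinear f" using assms(1) by (simp add: enveloping_def)
  from base show ?case unfolding uea_relations_def
  proof (elim UnE)
    assume "r \<in> {free_gen (x + y) - free_gen x - free_gen y | x y. True}"
    then show ?thesis by (auto simp: lin clinear_add[OF f])
  next
    assume "r \<in> {free_gen (c *\<^sub>C x) - c *\<^sub>C free_gen x | c x. True}"
    then show ?thesis by (auto simp: lin clinear_scale[OF f])
  next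
    assume "r \<in> {free_gen x * free_gen y - koszul i j *\<^sub>C (free_gen y * free_gen x)
      - free_gen (sbracket x y) | x y i j. x \<in> grade i \<and> y \<in> grade j}"
    then obtain x y i j where r: "x \<in> grade i" "y \<in> grade j" "r = free_gen x * free_gen y
      - koszul i j *\<^sub>C (free_gen y * free_gen x) - free_gen (sbracket x y)" by blast
    have "f x * f y - koszul i j *\<^sub>C (f y * f x) = f (sbracket x y)"
      using assms(1) r(1,2) unfolding enveloping_def by blast
    then show ?thesis unfolding r(3) by (simp add: lin)
  qed
qed (simp_all add: clinear_0[OF clinear_word_ext] clinear_add[OF clinear_word_ext] word_ext_mult)

lemma word_ext_cong:
  assumes "enveloping f" "uea_rel p q" shows "word_ext f p = word_ext f q"
  using word_ext_ideal[OF assms(1)] assms(2) clinear_diff[OF clinear_word_ext, of f p q]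
  unfolding uea_rel_def by fastforce

lemma enveloping_zero: "enveloping (\<lambda>_. 0)"
  by (simp add: enveloping_def clinear_zero)

instantiation uea :: (lie_superalgebra) complex_algebra_1
begin

lift_definition zero_uea :: "'a uea" is 0 .
lift_definition one_uea :: "'a uea" is 1 .
lift_definition plus_uea :: "'a uea \<Rightarrow> 'a uea \<Rightarrow> 'a uea" is "(+)"
  unfolding uea_rel_def by (drule (1) two_sided_ideal.add) (simp add: algebra_simps)
lift_definition uminus_uea :: "'a uea \<Rightarrow> 'a uea" is uminus
  unfolding uea_rel_def by (drule two_sided_ideal_minus) (simp add: algebra_simps)
lift_definition minus_uea :: "'a uea \<Rightarrow> 'a uea \<Rightarrow> 'a uea" is "(-)"
  unfolding uea_rel_def by (drule (1) two_sided_ideal_diff) (simp add: algebra_simps)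
lift_definition times_uea :: "'a uea \<Rightarrow> 'a uea \<Rightarrow> 'a uea" is "(*)"
  unfolding uea_rel_def
proof -
  fix p p' q q' :: "'a list \<Rightarrow>\<^sub>0 complex"
  assume "p - p' \<in> two_sided_ideal uea_relations" "q - q' \<in> two_sided_ideal uea_relations"
  then have "(p - p') * q + p' * (q - q') \<in> two_sided_ideal uea_relations"
    by (intro two_sided_ideal.add two_sided_ideal.mult_left two_sided_ideal.mult_right)
  then show "p * q - p' * q' \<in> two_sided_ideal uea_relations" by (simp add: algebra_simps)
qed
lift_definition scaleC_uea :: "complex \<Rightarrow> 'a uea \<Rightarrow> 'a uea" is "scaleC"
  unfolding uea_rel_def
  by (simp add: scaleC_poly_mapping_mult two_sided_ideal.mult_left flip: right_diff_distrib)

instance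
proof
  fix a b c :: "'a uea" and r s :: complex
  have refl: "uea_rel p q" if "p = q" for p q :: "'a list \<Rightarrow>\<^sub>0 complex"
    using that by (simp add: uea_rel_def two_sided_ideal.zero)
  show "a + b + c = a + (b + c)" by transfer (simp add: refl algebra_simps)
  show "a + b = b + a" by transfer (simp add: refl algebra_simps)
  show "0 + a = a" by transfer (simp add: refl algebra_simps)
  show "- a + a = 0" by transfer (simp add: refl algebra_simps)
  show "a - b = a + - b" by transfer (simp add: refl algebra_simps)
  show "a * b * c = a * (b * c)" by transfer (simp add: refl algebra_simps)
  show "(a + b) * c = a * c + b * c" by transfer (simp add: refl algebra_simps)
  show "a * (b + c) = a * b + a * c" by transfer (simp add: refl algebra_simps)
  show "1 * a = a" by transfer (simp add: refl algebra_simps)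
  show "a * 1 = a" by transfer (simp add: refl algebra_simps)
  show "r *\<^sub>C (a + b) = r *\<^sub>C a + r *\<^sub>C b" by transfer (simp add: refl scaleC_distribs)
  show "(r + s) *\<^sub>C a = r *\<^sub>C a + s *\<^sub>C a" by transfer (simp add: refl scaleC_distribs)
  show "r *\<^sub>C s *\<^sub>C a = (r * s) *\<^sub>C a" by transfer (simp add: refl)
  show "1 *\<^sub>C a = a" by transfer (simp add: refl)
  show "(r *\<^sub>C a) * b = r *\<^sub>C (a * b)"
    by transfer (simp add: refl scaleC_poly_mapping_mult mult.assoc)
  show "a * (r *\<^sub>C b) = r *\<^sub>C (a * b)"
    by transfer (simp add: refl scaleC_poly_mapping_mult_right mult.assoc)
  show "(0::'a uea) \<noteq> 1"
  proof transfer
    have "\<not> uea_rel 0 (1::'a list \<Rightarrow>\<^sub>0 complex)"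
      using word_ext_cong[where f = "\<lambda>_::'a. 0::complex", OF enveloping_zero, of 0 1]
        word_ext_1[of "\<lambda>_::'a. 0::complex"] clinear_0[OF clinear_word_ext, of "\<lambda>_::'a. 0::complex"]
      by auto
    then show "\<not> uea_rel 0 (1::'a list \<Rightarrow>\<^sub>0 complex)" .
  qed
qed

end


definition uea_gen :: "'g::lie_superalgebra \<Rightarrow> 'g uea"
  where "uea_gen x = abs_uea (free_gen x)"

lemma abs_uea_eqI: "p - q \<in> two_sided_ideal uea_relations \<Longrightarrow> abs_uea p = abs_uea q"
  by (simp add: uea.abs_eq_iff uea_rel_def)

lemmas abs_uea_simps = plus_uea.abs_eq[symmetric] minus_uea.abs_eq[symmetric]
  times_uea.abs_eq[symmetric] scaleC_uea.abs_eq[symmetric]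

lemma clinear_uea_gen: "clinear uea_gen"
proof (rule clinearI)
  fix x y :: 'a and c
  have "free_gen (x + y) - free_gen x - free_gen y \<in> two_sided_ideal uea_relations"
    by (rule two_sided_ideal.base) (auto simp: uea_relations_def)
  then have "abs_uea (free_gen (x + y)) = abs_uea (free_gen x + free_gen y)"
    by (intro abs_uea_eqI) (simp add: algebra_simps)
  then show "uea_gen (x + y) = uea_gen x + uea_gen y"
    by (simp add: uea_gen_def abs_uea_simps)
  have "free_gen (c *\<^sub>C x) - c *\<^sub>C free_gen x \<in> two_sided_ideal uea_relations"
    by (rule two_sided_ideal.base) (auto simp: uea_relations_def)
  then show "uea_gen (c *\<^sub>C x) = c *\<^sub>C uea_gen x"
    unfolding uea_gen_def scaleC_uea.abs_eq by (rule abs_uea_eqI)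
qed

lemma enveloping_uea_gen: "enveloping uea_gen"
  unfolding enveloping_def
proof (intro conjI allI ballI clinear_uea_gen)
  fix x y :: 'a and i j assume "x \<in> grade i" "y \<in> grade j"
  then have "free_gen x * free_gen y - koszul i j *\<^sub>C (free_gen y * free_gen x)
      - free_gen (sbracket x y) \<in> two_sided_ideal uea_relations"
    by (intro two_sided_ideal.base) (auto simp: uea_relations_def)
  from abs_uea_eqI[OF this]
  show "uea_gen x * uea_gen y - koszul i j *\<^sub>C (uea_gen y * uea_gen x) = uea_gen (sbracket x y)"
    by (simp add: uea_gen_def abs_uea_simps)
qed

text \<open>Meaningful only if \<open>f\<close> satisfies \<open>enveloping\<close>: then it is the induced algebra
  homomorphism, independently of the representative.\<close>

definition uea_lift :: "('g::lie_superalgebra \<Rightarrow> 'a::complex_algebra_1) \<Rightarrow> 'g uea \<Rightarrow> 'a"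
  where "uea_lift f u = word_ext f (rep_uea u)"

lemma uea_lift_abs: "enveloping f \<Longrightarrow> uea_lift f (abs_uea p) = word_ext f p"
  unfolding uea_lift_def
  by (rule word_ext_cong) (simp_all add: Quotient3_uea rep_abs_rsp_left uea_rel_equivp equivp_reflp)

lemma uea_lift_gen: "enveloping f \<Longrightarrow> uea_lift f (uea_gen x) = f x"
  by (simp add: uea_gen_def uea_lift_abs word_ext_gen)

lemma uea_lift_1: "enveloping f \<Longrightarrow> uea_lift f 1 = 1"
  by (simp add: one_uea.abs_eq uea_lift_abs word_ext_1)

lemma uea_lift_mult: "enveloping f \<Longrightarrow> uea_lift f (u * v) = uea_lift f u * uea_lift f v"
  by (induction u rule: uea.abs_induct, induction v rule: uea.abs_induct)
    (simp add: times_uea.abs_eq uea_lift_abs word_ext_mult)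

lemma clinear_uea_lift:
  assumes "enveloping f" shows "clinear (uea_lift f)"
proof (rule clinearI)
  fix u v :: "'a uea" and c
  show "uea_lift f (u + v) = uea_lift f u + uea_lift f v"
    by (induction u rule: uea.abs_induct, induction v rule: uea.abs_induct)
      (simp add: plus_uea.abs_eq uea_lift_abs assms clinear_add[OF clinear_word_ext])
  show "uea_lift f (c *\<^sub>C u) = c *\<^sub>C uea_lift f u"
    by (induction u rule: uea.abs_induct)
      (simp add: scaleC_uea.abs_eq uea_lift_abs assms clinear_scale[OF clinear_word_ext])
qed

lemma abs_uea_word: "abs_uea (Poly_Mapping.single w c) = c *\<^sub>C prod_list (map uea_gen w)"
proof (induction w)
  case Nil
  have "Poly_Mapping.single [] c = c *\<^sub>C (1 :: 'a list \<Rightarrow>\<^sub>0 complex)"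
    by (simp add: scaleC_single zero_list_def flip: single_one)
  then show ?case by (simp add: one_uea.abs_eq scaleC_uea.abs_eq)
next
  case (Cons x w)
  have "Poly_Mapping.single (x # w) c = free_gen x * Poly_Mapping.single w c"
    by (simp add: free_gen_def mult_single plus_list_def)
  then show ?case by (simp add: abs_uea_simps Cons uea_gen_def scaleC_mult_right)
qed

lemma uea_induct [case_names one gen add scale]:
  assumes "P 1"
    and "\<And>x i u. x \<in> grade i \<Longrightarrow> P u \<Longrightarrow> P (uea_gen x * u)"
    and add: "\<And>u v. P u \<Longrightarrow> P v \<Longrightarrow> P (u + v)"
    and scale: "\<And>c u. P u \<Longrightarrow> P (c *\<^sub>C u)"
  shows "P u"
proof (induction u rule: uea.abs_induct)
  case (1 p)
  have word: "P (prod_list (map uea_gen w))" for w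
  proof (induction w)
    case (Cons x w)
    have "uea_gen x = uea_gen (hcomp 0 x) + uea_gen (hcomp 1 x)"
      by (simp add: hcomp_sum flip: clinear_add[OF clinear_uea_gen])
    with Cons show ?case
      using assms(2)[OF hcomp_grade[of 0 x] Cons] assms(2)[OF hcomp_grade[of 1 x] Cons] add
      by (simp add: distrib_right)
  qed (simp add: assms(1))
  show ?case
    by (induction p rule: poly_mapping_induct)
      (simp_all add: abs_uea_word word scale add flip: plus_uea.abs_eq)
qed

text \<open>The parity automorphism; it shows that the grading below is a direct sum.\<close>

definition uea_par :: "'g::lie_superalgebra uea \<Rightarrow> 'g uea"
  where "uea_par = uea_lift (\<lambda>x. uea_gen (hcomp 0 x - hcomp 1 x))"

lemma par_grade: "x \<in> grade i \<Longrightarrow> hcomp 0 x - hcomp 1 x = koszul 1 i *\<^sub>C x"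
  by (cases i) (simp_all add: hcomp_same hcomp_other)

lemma koszul_add: "koszul (i + j) l = koszul i l * koszul j l"
  "koszul l (i + j) = koszul l i * koszul l j"
  by (cases i; cases j; cases l; simp)+

lemma koszul_square [simp]: "koszul i j * koszul i j = 1" "koszul i j * (koszul i j * c) = c"
  by (cases i; cases j; simp)+

lemma enveloping_par: "enveloping (\<lambda>x. uea_gen (hcomp 0 x - hcomp 1 x))"
  unfolding enveloping_def
proof (intro conjI allI ballI)
  show "clinear (\<lambda>x. uea_gen (hcomp 0 x - hcomp 1 x :: 'a))"
    by (intro clinear_compose[OF clinear_uea_gen] clinear_minus2 clinear_hcomp)
  fix i j and x y :: 'a assume xy: "x \<in> grade i" "y \<in> grade j"
  have "uea_gen x * uea_gen y - koszul i j *\<^sub>C (uea_gen y * uea_gen x) = uea_gen (sbracket x y)"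
    using enveloping_uea_gen xy unfolding enveloping_def by blast
  note this[symmetric]
  then show "uea_gen (hcomp 0 x - hcomp 1 x) * uea_gen (hcomp 0 y - hcomp 1 y) -
      koszul i j *\<^sub>C (uea_gen (hcomp 0 y - hcomp 1 y) * uea_gen (hcomp 0 x - hcomp 1 x)) =
      uea_gen (hcomp 0 (sbracket x y) - hcomp 1 (sbracket x y))"
    by (simp add: par_grade[OF xy(1)] par_grade[OF xy(2)] par_grade[OF sbracket_grade[OF xy]]
        clinear_scale[OF clinear_uea_gen] scaleC_mult_left scaleC_mult_right koszul_add
        scaleC_distribs mult_ac)
qed

lemma clinear_uea_par: "clinear uea_par"
  unfolding uea_par_def by (rule clinear_uea_lift[OF enveloping_par])

definition hom_monomials :: "bit \<Rightarrow> 'g::lie_superalgebra uea set"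
  where "hom_monomials i =
    {prod_list (map uea_gen xs) | xs js. list_all2 (\<lambda>x j. x \<in> grade j) xs js \<and> sum_list js = i}"

lemma hom_monomials_one: "1 \<in> hom_monomials 0"
  unfolding hom_monomials_def by (rule CollectI, rule exI[of _ "[]"]) auto

lemma hom_monomials_mult:
  assumes "a \<in> hom_monomials i" "b \<in> hom_monomials j" shows "a * b \<in> hom_monomials (i + j)"
proof -
  from assms obtain xs is' ys js where
    "list_all2 (\<lambda>x j. x \<in> grade j) xs is'" "sum_list is' = i" "a = prod_list (map uea_gen xs)"
    "list_all2 (\<lambda>x j. x \<in> grade j) ys js" "sum_list js = j" "b = prod_list (map uea_gen ys)"
    unfolding hom_monomials_def by blast
  then have "list_all2 (\<lambda>x j. x \<in> grade j) (xs @ ys) (is' @ js)" "sum_list (is' @ js) = i + j"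
    "a * b = prod_list (map uea_gen (xs @ ys))"
    by (auto intro: list_all2_appendI)
  then show ?thesis unfolding hom_monomials_def by blast
qed

lemma hom_monomials_gen: "x \<in> grade i \<Longrightarrow> uea_gen x \<in> hom_monomials i"
  unfolding hom_monomials_def
  by (rule CollectI, rule exI[of _ "[x]"], rule exI[of _ "[i]"]) auto

lemma uea_par_monomial:
  assumes "m \<in> hom_monomials i" shows "uea_par m = koszul 1 i *\<^sub>C m"
proof -
  have "uea_par (prod_list (map uea_gen xs)) = koszul 1 (sum_list js) *\<^sub>C prod_list (map uea_gen xs)"
    if "list_all2 (\<lambda>x j. x \<in> grade j) xs js" for xs :: "'a list" and js
    using that
  proof induction
    case Nil
    show ?case by (simp add: uea_par_def uea_lift_1[OF enveloping_par])
  next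
    case (Cons x xs j js)
    then show ?case
      by (simp add: uea_par_def uea_lift_mult[OF enveloping_par] uea_lift_gen[OF enveloping_par]
          par_grade clinear_scale[OF clinear_uea_gen] scaleC_mult_left scaleC_mult_right koszul_add mult_ac)
  qed
  with assms show ?thesis unfolding hom_monomials_def by blast
qed

instantiation uea :: (lie_superalgebra) superalgebra
begin

definition grade_uea :: "bit \<Rightarrow> 'a uea set"
  where "grade_uea i = cspan (hom_monomials i)"

instance
proof
  fix i j :: bit and x y a b :: "'a uea" and c :: complex
  show "(0::'a uea) \<in> grade i" by (simp add: grade_uea_def complex_vector.span_zero)
  show "x \<in> grade i \<Longrightarrow> y \<in> grade i \<Longrightarrow> x + y \<in> grade i"
    by (simp add: grade_uea_def complex_vector.span_add)
  show "x \<in> grade i \<Longrightarrow> c *\<^sub>C x \<in> grade i"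
    by (simp add: grade_uea_def complex_vector.span_scale)
  show one_grade: "(1::'a uea) \<in> grade 0"
    by (simp add: grade_uea_def complex_vector.span_base hom_monomials_one)
  have mult: "a * b \<in> grade (i + j)" if "a \<in> grade i" "b \<in> grade j" for a b :: "'a uea" and i j
  proof -
    have 1: "a * b \<in> grade (i + j)" if "a \<in> hom_monomials i" for a
      using \<open>b \<in> grade j\<close> unfolding grade_uea_def
    proof (induction rule: complex_vector.span_induct)
      case base
      show ?case
        by (auto simp: csubspace_def distrib_left scaleC_mult_right complex_vector.span_zero
            complex_vector.span_add complex_vector.span_scale)
    next
      case (step b)
      then show ?case using that by (simp add: hom_monomials_mult complex_vector.span_base)
    qed
    show ?thesis
      using \<open>a \<in> grade i\<close> unfolding grade_uea_def[of i]
    proof (induction rule: complex_vector.span_induct)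
      case base
      show ?case
        by (auto simp: grade_uea_def csubspace_def distrib_right scaleC_mult_left
            complex_vector.span_zero complex_vector.span_add complex_vector.span_scale)
    qed (rule 1)
  qed
  then show "a \<in> grade i \<Longrightarrow> b \<in> grade j \<Longrightarrow> a * b \<in> grade (i + j)" .
  have par: "uea_par u = koszul 1 i *\<^sub>C u" if "u \<in> grade i" for u :: "'a uea" and i
    using that unfolding grade_uea_def
  proof (induction rule: complex_vector.span_induct)
    case base
    show ?case by (rule csubspace_eq) (intro clinear_uea_par clinear_scaleC clinear_id)+
  qed (rule uea_par_monomial)
  show "grade 0 \<inter> grade 1 = {0 :: 'a uea}"
  proof -
    have "u = 0" if "u \<in> grade 0" "u \<in> grade 1" for u :: "'a uea"
    proof -
      have "u = - u" using par[OF that(1)] par[OF that(2)] by simp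
      then have "u + u = 0" by (metis add.right_inverse)
      then have "2 *\<^sub>C u = 0"
        using scaleC_add_left[of 1 1 u] by simp
      then show ?thesis by simp
    qed
    then show ?thesis by (auto simp: grade_uea_def complex_vector.span_zero)
  qed
  show "\<exists>y\<in>grade 0. \<exists>z\<in>grade 1. x = y + z"
  proof (induction x rule: uea_induct)
    case one
    then show ?case using one_grade
      by (intro bexI[of _ 1] bexI[of _ 0]) (auto simp: grade_uea_def complex_vector.span_zero)
  next
    case (gen x i u)
    then obtain y z where yz: "y \<in> grade 0" "z \<in> grade 1" "u = y + z" by blast
    have "uea_gen x \<in> grade i" using gen(1)
      by (simp add: grade_uea_def complex_vector.span_base hom_monomials_gen)
    then have "uea_gen x * y \<in> grade i" "uea_gen x * z \<in> grade (i + 1)"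
      using mult[of "uea_gen x" i] yz by force+
    then show ?case unfolding yz(3) distrib_left
      by (cases i) (simp, blast, simp, metis add.commute)
  next
    case (add u v)
    then obtain y z y' z' where "y \<in> grade 0" "z \<in> grade 1" "u = y + z"
      "y' \<in> grade 0" "z' \<in> grade 1" "v = y' + z'" by blast
    then show ?case
      by (intro bexI[of _ "y + y'"] bexI[of _ "z + z'"])
        (auto simp: grade_uea_def complex_vector.span_add)
  next
    case (scale c u)
    then obtain y z where "y \<in> grade 0" "z \<in> grade 1" "u = y + z" by blast
    then show ?case
      by (intro bexI[of _ "c *\<^sub>C y"] bexI[of _ "c *\<^sub>C z"])
        (auto simp: grade_uea_def complex_vector.span_scale scaleC_distribs)
  qed
qed

end

lemma uea_gen_grade: "x \<in> grade i \<Longrightarrow> uea_gen x \<in> grade i"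
  by (simp add: grade_uea_def complex_vector.span_base hom_monomials_gen)

section \<open>Tensor products\<close>

definition tensor_relations ::
  "(('a::complex_vector \<times> 'b::complex_vector) \<Rightarrow>\<^sub>0 complex) set"
  where "tensor_relations =
    {Poly_Mapping.single (a + a', b) 1 - Poly_Mapping.single (a, b) 1
      - Poly_Mapping.single (a', b) 1 | a a' b. True} \<union>
    {Poly_Mapping.single (a, b + b') 1 - Poly_Mapping.single (a, b) 1
      - Poly_Mapping.single (a, b') 1 | a b b'. True} \<union>
    {Poly_Mapping.single (c *\<^sub>C a, b) 1 - Poly_Mapping.single (a, b) c | a b c. True} \<union>
    {Poly_Mapping.single (a, c *\<^sub>C b) 1 - Poly_Mapping.single (a, b) c | a b c. True}"

definition tensor_rel :: "(('a::complex_vector \<times> 'b::complex_vector) \<Rightarrow>\<^sub>0 complex) \<Rightarrow>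
    (('a \<times> 'b) \<Rightarrow>\<^sub>0 complex) \<Rightarrow> bool"
  where "tensor_rel p q \<longleftrightarrow> p - q \<in> cspan tensor_relations"

lemma tensor_rel_equivp: "equivp tensor_rel"
proof -
  have "x - z \<in> cspan R" if "x - y \<in> cspan R" "y - z \<in> cspan R" for x y z :: "'z::complex_vector" and R
    using complex_vector.span_add[OF that] by simp
  moreover have "y - x \<in> cspan R" if "x - y \<in> cspan R" for x y :: "'z::complex_vector" and R
    using complex_vector.span_neg[OF that] by simp
  ultimately show ?thesis
    unfolding equivp_reflp_symp_transp reflp_def symp_def transp_def tensor_rel_def
    by (simp add: complex_vector.span_zero) blast
qed

quotient_type (overloaded) ('a, 'b) tensor =
  "('a::complex_vector \<times> 'b::complex_vector) \<Rightarrow>\<^sub>0 complex" / tensor_rel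
  by (rule tensor_rel_equivp)

instantiation tensor :: (complex_vector, complex_vector) complex_vector
begin

lift_definition zero_tensor :: "('a, 'b) tensor" is 0 .
lift_definition plus_tensor :: "('a, 'b) tensor \<Rightarrow> ('a, 'b) tensor \<Rightarrow> ('a, 'b) tensor" is "(+)"
  unfolding tensor_rel_def by (drule (1) complex_vector.span_add) (simp add: algebra_simps)
lift_definition uminus_tensor :: "('a, 'b) tensor \<Rightarrow> ('a, 'b) tensor" is uminus
  unfolding tensor_rel_def by (drule complex_vector.span_neg) (simp add: algebra_simps)
lift_definition minus_tensor :: "('a, 'b) tensor \<Rightarrow> ('a, 'b) tensor \<Rightarrow> ('a, 'b) tensor" is "(-)"
  unfolding tensor_rel_def by (drule (1) complex_vector.span_diff) (simp add: algebra_simps)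
lift_definition scaleC_tensor :: "complex \<Rightarrow> ('a, 'b) tensor \<Rightarrow> ('a, 'b) tensor" is scaleC
  unfolding tensor_rel_def
  by (simp add: complex_vector.span_scale flip: complex_vector.scale_right_diff_distrib)

instance
proof
  fix a b c :: "('a, 'b) tensor" and r s :: complex
  have refl: "tensor_rel p q" if "p = q" for p q :: "('a \<times> 'b) \<Rightarrow>\<^sub>0 complex"
    using that by (simp add: tensor_rel_def complex_vector.span_zero)
  show "a + b + c = a + (b + c)" by transfer (simp add: refl algebra_simps)
  show "a + b = b + a" by transfer (simp add: refl algebra_simps)
  show "0 + a = a" by transfer (simp add: refl algebra_simps)
  show "- a + a = 0" by transfer (simp add: refl algebra_simps)
  show "a - b = a + - b" by transfer (simp add: refl algebra_simps)
  show "r *\<^sub>C (a + b) = r *\<^sub>C a + r *\<^sub>C b" by transfer (simp add: refl scaleC_distribs)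
  show "(r + s) *\<^sub>C a = r *\<^sub>C a + s *\<^sub>C a" by transfer (simp add: refl scaleC_distribs)
  show "r *\<^sub>C s *\<^sub>C a = (r * s) *\<^sub>C a" by transfer (simp add: refl)
  show "1 *\<^sub>C a = a" by transfer (simp add: refl)
qed

end

definition tensor_of :: "'a::complex_vector \<Rightarrow> 'b::complex_vector \<Rightarrow> ('a, 'b) tensor"
    (infixr \<open>\<otimes>\<close> 76)
  where "a \<otimes> b = abs_tensor (Poly_Mapping.single (a, b) 1)"

lemma abs_tensor_eqI: "p - q \<in> cspan tensor_relations \<Longrightarrow> abs_tensor p = abs_tensor q"
  by (simp add: tensor.abs_eq_iff tensor_rel_def)

lemma abs_tensor_single: "abs_tensor (Poly_Mapping.single (a, b) c) = c *\<^sub>C (a \<otimes> b)"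
  by (simp add: tensor_of_def scaleC_tensor.abs_eq scaleC_single)

lemma tensor_add_left: "(a + a') \<otimes> b = a \<otimes> b + a' \<otimes> b"
  unfolding tensor_of_def plus_tensor.abs_eq
  by (intro abs_tensor_eqI complex_vector.span_base)
    (simp add: tensor_relations_def diff_diff_eq[symmetric], blast)

lemma tensor_add_right: "a \<otimes> (b + b') = a \<otimes> b + a \<otimes> b'"
  unfolding tensor_of_def plus_tensor.abs_eq
  by (intro abs_tensor_eqI complex_vector.span_base)
    (simp add: tensor_relations_def diff_diff_eq[symmetric], blast)

lemma tensor_scale_left: "(c *\<^sub>C a) \<otimes> b = c *\<^sub>C (a \<otimes> b)"
  unfolding abs_tensor_single[symmetric] unfolding tensor_of_def
  by (intro abs_tensor_eqI complex_vector.span_base) (simp add: tensor_relations_def, blast)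

lemma tensor_scale_right: "a \<otimes> (c *\<^sub>C b) = c *\<^sub>C (a \<otimes> b)"
  unfolding abs_tensor_single[symmetric] unfolding tensor_of_def
  by (intro abs_tensor_eqI complex_vector.span_base) (simp add: tensor_relations_def, blast)

lemma clinear_tensor_left: "clinear f \<Longrightarrow> clinear (\<lambda>a. f a \<otimes> b)"
  and clinear_tensor_right: "clinear f \<Longrightarrow> clinear (\<lambda>a. b \<otimes> f a)"
  by (simp_all add: clinear_iff tensor_add_left tensor_add_right tensor_scale_left tensor_scale_right)

lemma tensor_induct [case_names tensor add]:
  assumes "\<And>a b. P (a \<otimes> b)" "\<And>s t. P s \<Longrightarrow> P t \<Longrightarrow> P (s + t)"
  shows "P t"
proof (induction t rule: tensor.abs_induct)
  case (1 p)
  show ?case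
  proof (induction p rule: poly_mapping_induct)
    case (single x c)
    then show ?case using assms(1)[of "c *\<^sub>C fst x" "snd x"]
      by (cases x) (simp add: abs_tensor_single tensor_scale_left)
  qed (simp add: assms flip: plus_tensor.abs_eq)
qed

lemma tensor_induct_hom [case_names tensor add]:
  fixes P :: "('a::superspace, 'b::superspace) tensor \<Rightarrow> bool"
  assumes "\<And>a b i j. a \<in> grade i \<Longrightarrow> b \<in> grade j \<Longrightarrow> P (a \<otimes> b)"
    and add: "\<And>s t. P s \<Longrightarrow> P t \<Longrightarrow> P (s + t)"
  shows "P t"
proof (induction t rule: tensor_induct)
  case (tensor a b)
  have "a \<otimes> b = (hcomp 0 a + hcomp 1 a) \<otimes> (hcomp 0 b + hcomp 1 b)"
    by (simp only: hcomp_sum)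
  also have "P \<dots>"
    unfolding tensor_add_left tensor_add_right by (intro add assms(1)) (rule hcomp_grade)+
  finally show ?case .
qed (rule add)

text \<open>The linear map out of the tensor product induced by a bilinear map; meaningful only for
  bilinear \<open>f\<close>.\<close>

definition tensor_lift ::
  "('a::complex_vector \<Rightarrow> 'b::complex_vector \<Rightarrow> 'c::complex_vector) \<Rightarrow> ('a, 'b) tensor \<Rightarrow> 'c"
  where "tensor_lift f t = lin_ext (\<lambda>(a, b). f a b) (rep_tensor t)"

lemma tensor_lift_abs:
  assumes "cbilinear f" shows "tensor_lift f (abs_tensor p) = lin_ext (\<lambda>(a, b). f a b) p"
proof -
  let ?L = "lin_ext (\<lambda>(a, b). f a b)"
  have f: "clinear (f x)" "clinear (\<lambda>x. f x y)" for x y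
    using assms by (simp_all add: cbilinear_def)
  have "?L q = 0" if "q \<in> cspan tensor_relations" for q
    using that
  proof (induction rule: complex_vector.span_induct)
    case base
    show ?case by (rule csubspace_ker) (rule clinear_lin_ext)
  next
    case (step r)
    then show ?case unfolding tensor_relations_def
      by (auto simp: clinear_diff[OF clinear_lin_ext] clinear_add[OF f(1)] clinear_add[OF f(2)]
          clinear_scale[OF f(1)] clinear_scale[OF f(2)])
  qed
  moreover have "tensor_rel (rep_tensor (abs_tensor p)) p"
    by (simp add: Quotient3_tensor rep_abs_rsp_left tensor_rel_equivp equivp_reflp)
  ultimately show ?thesis
    unfolding tensor_lift_def tensor_rel_def
    using clinear_diff[OF clinear_lin_ext, of "\<lambda>(a, b). f a b" "rep_tensor (abs_tensor p)" p]
    by simp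
qed

lemma tensor_lift_tensor: "cbilinear f \<Longrightarrow> tensor_lift f (a \<otimes> b) = f a b"
  by (simp add: tensor_of_def tensor_lift_abs)

lemma clinear_tensor_lift:
  assumes "cbilinear f" shows "clinear (tensor_lift f)"
proof (rule clinearI)
  fix s t :: "('a, 'b) tensor" and c
  show "tensor_lift f (s + t) = tensor_lift f s + tensor_lift f t"
    by (induction s rule: tensor.abs_induct, induction t rule: tensor.abs_induct)
      (simp add: plus_tensor.abs_eq tensor_lift_abs assms clinear_add[OF clinear_lin_ext])
  show "tensor_lift f (c *\<^sub>C s) = c *\<^sub>C tensor_lift f s"
    by (induction s rule: tensor.abs_induct)
      (simp add: scaleC_tensor.abs_eq tensor_lift_abs assms clinear_scale[OF clinear_lin_ext])
qed

text \<open>The product on the tensor product of two superalgebras: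
  \<open>(a \<otimes> b)(c \<otimes> d) = (-1)\<^sup>|\<^sup>b\<^sup>|\<^sup>|\<^sup>c\<^sup>| ac \<otimes> bd\<close> for homogeneous \<open>b\<close> and \<open>c\<close>,
  extended bilinearly.\<close>

definition tensor_times :: "'a::superalgebra \<Rightarrow> 'b::superalgebra \<Rightarrow> 'a \<Rightarrow> 'b \<Rightarrow> ('a, 'b) tensor"
  where "tensor_times a b c d =
    (\<Sum>i\<in>{0, 1}. \<Sum>j\<in>{0, 1}. koszul i j *\<^sub>C ((a * hcomp j c) \<otimes> (hcomp i b * d)))"

lemma cbilinear_tensor_times: "cbilinear (tensor_times a b)"
  unfolding cbilinear_def tensor_times_def
  by (intro conjI allI clinear_sumf clinear_scaleC clinear_tensor_left clinear_tensor_right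
      clinear_mult_left clinear_hcomp clinear_id)

lemma cbilinear_tensor_times2: "cbilinear (\<lambda>a b. tensor_lift (tensor_times a b) t)"
proof -
  note lin = clinear_tensor_lift[OF cbilinear_tensor_times]
  have bil: "cbilinear (\<lambda>a b. tensor_times a b c d)" for c :: 'a and d :: 'b
    unfolding cbilinear_def tensor_times_def
    by (intro conjI allI clinear_sumf clinear_scaleC clinear_tensor_left clinear_tensor_right
        clinear_mult_right clinear_hcomp clinear_id)
  show ?thesis
  proof (induction t rule: tensor_induct)
    case (tensor c d)
    show ?case unfolding tensor_lift_tensor[OF cbilinear_tensor_times] by (rule bil)
  next
    case (add s t)
    then show ?case by (simp add: clinear_add[OF lin] cbilinear_def clinear_plus)
  qed
qed

instantiation tensor :: (superalgebra, superalgebra) complex_algebra_1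
begin

definition one_tensor :: "('a, 'b) tensor"
  where "1 = 1 \<otimes> 1"

definition times_tensor :: "('a, 'b) tensor \<Rightarrow> ('a, 'b) tensor \<Rightarrow> ('a, 'b) tensor"
  where "s * t = tensor_lift (\<lambda>a b. tensor_lift (tensor_times a b) t) s"

lemma tensor_mult: "(a \<otimes> b) * (c \<otimes> d) = tensor_times a b c d"
  for a c :: 'a and b d :: 'b
  unfolding times_tensor_def tensor_lift_tensor[OF cbilinear_tensor_times2]
  by (rule tensor_lift_tensor[OF cbilinear_tensor_times])

lemma tensor_mult_hom: "b \<in> grade i \<Longrightarrow> c \<in> grade j \<Longrightarrow>
    (a \<otimes> b) * (c \<otimes> d) = koszul i j *\<^sub>C ((a * c) \<otimes> (b * d))"
  for a c :: 'a and b d :: 'b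
  unfolding tensor_mult tensor_times_def
  by (cases i; cases j)
    (simp_all add: hcomp_same hcomp_other clinear_0[OF clinear_tensor_left[OF clinear_id]]
      clinear_0[OF clinear_tensor_right[OF clinear_id]])

lemma clinear_times_tensor: "clinear (\<lambda>s. s * t)" "clinear (\<lambda>t. s * t)"
  for s t :: "('a, 'b) tensor"
proof -
  show "clinear (\<lambda>s. s * t)"
    unfolding times_tensor_def by (rule clinear_tensor_lift) (rule cbilinear_tensor_times2)
  show "clinear (\<lambda>t. s * t)"
  proof (induction s rule: tensor_induct)
    case (tensor a b)
    show ?case
      by (simp add: times_tensor_def tensor_lift_tensor cbilinear_tensor_times2
          clinear_tensor_lift cbilinear_tensor_times)
  next
    case (add s t)
    then show ?case
      by (simp add: times_tensor_def clinear_add[OF clinear_tensor_lift]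
          cbilinear_tensor_times2 clinear_plus)
  qed
qed

instance
proof
  fix r s t :: "('a, 'b) tensor" and c :: complex
  note add = clinear_add[OF clinear_times_tensor(1)] clinear_add[OF clinear_times_tensor(2)]
  note scale = clinear_scale[OF clinear_times_tensor(1)] clinear_scale[OF clinear_times_tensor(2)]
  show "(r + s) * t = r * t + s * t" "r * (s + t) = r * s + r * t" by (rule add)+
  show "(c *\<^sub>C s) * t = c *\<^sub>C (s * t)" "s * (c *\<^sub>C t) = c *\<^sub>C (s * t)" by (rule scale)+
  show "1 * s = s"
    by (induction s rule: tensor_induct_hom)
      (simp_all add: one_tensor_def tensor_mult_hom[OF grade_one] add)
  show "s * 1 = s"
    by (induction s rule: tensor_induct_hom)
      (simp_all add: one_tensor_def tensor_mult_hom[OF _ grade_one] add)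
  show "r * s * t = r * (s * t)"
  proof (induction r rule: tensor_induct_hom)
    case (tensor a b i j)
    show ?case
    proof (induction s rule: tensor_induct_hom)
      case (tensor a' b' i' j')
      show ?case
      proof (induction t rule: tensor_induct_hom)
        case (tensor a'' b'' i'' j'')
        show ?case
          using tensor \<open>a \<in> grade i\<close> \<open>b \<in> grade j\<close> \<open>a' \<in> grade i'\<close> \<open>b' \<in> grade j'\<close>
          by (simp add: tensor_mult_hom[of _ j _ i'] tensor_mult_hom[of _ j' _ i'']
              tensor_mult_hom[of _ "j + j'" _ i''] tensor_mult_hom[of _ j _ "i' + i''"]
              grade_mult scale mult.assoc koszul_add mult_ac(2,3))
      qed (simp add: add)
    qed (simp add: add)
  qed (simp add: add)
  show "(0 :: ('a, 'b) tensor) \<noteq> 1"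
  proof
    assume zero: "(0 :: ('a, 'b) tensor) = 1"
    have ex: "\<exists>f :: 'z \<Rightarrow> complex. clinear f \<and> f x \<noteq> 0" if "x \<noteq> 0" for x :: "'z::complex_vector"
    proof -
      interpret vector_space_pair "scaleC :: complex \<Rightarrow> 'z \<Rightarrow> 'z" "scaleC :: complex \<Rightarrow> complex \<Rightarrow> complex"
        by unfold_locales
      have "\<not> module.dependent scaleC {x}"
        using that by (simp add: complex_vector.independent_insert complex_vector.independent_empty)
      then obtain f :: "'z \<Rightarrow> complex" where "clinear f" "\<forall>y\<in>{x}. f y = 1"
        using linear_independent_extend[of "{x}" "\<lambda>_. 1"] by blast
      then show ?thesis by auto
    qed
    obtain f :: "'a \<Rightarrow> complex" where f: "clinear f" "f 1 \<noteq> 0" using ex[of "1 :: 'a"] by auto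
    obtain g :: "'b \<Rightarrow> complex" where g: "clinear g" "g 1 \<noteq> 0" using ex[of "1 :: 'b"] by auto
    have "cbilinear (\<lambda>a b. f a * g b)"
      unfolding cbilinear_def
      by (intro conjI allI clinear_mult_left clinear_mult_right f g)
    then have "tensor_lift (\<lambda>a b. f a * g b) (1 \<otimes> 1) = f 1 * g 1"
      "tensor_lift (\<lambda>a b. f a * g b) 0 = 0"
      by (simp_all only: tensor_lift_tensor clinear_0[OF clinear_tensor_lift])
    then show False using zero f g by (simp add: one_tensor_def)
  qed
qed

end

section \<open>The Hopf superalgebra structure\<close>

definition coproduct :: "'g::lie_superalgebra uea \<Rightarrow> ('g uea, 'g uea) tensor"
  where "coproduct = uea_lift (\<lambda>x. 1 \<otimes> uea_gen x + uea_gen x \<otimes> 1)"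

definition counit :: "'g::lie_superalgebra uea \<Rightarrow> complex"
  where "counit = uea_lift (\<lambda>_. 0)"

lemma enveloping_coproduct:
  "enveloping (\<lambda>x::'g::lie_superalgebra. 1 \<otimes> uea_gen x + uea_gen x \<otimes> (1 :: 'g uea))"
  unfolding enveloping_def
proof (intro conjI allI ballI)
  show "clinear (\<lambda>x::'g. 1 \<otimes> uea_gen x + uea_gen x \<otimes> (1 :: 'g uea))"
    by (intro clinear_plus clinear_tensor_left clinear_tensor_right clinear_uea_gen)
  fix i j and x y :: 'g assume xy: "x \<in> grade i" "y \<in> grade j"
  have br: "uea_gen (sbracket x y) = uea_gen x * uea_gen y - koszul i j *\<^sub>C (uea_gen y * uea_gen x)"
    using enveloping_uea_gen xy unfolding enveloping_def by fastforce
  have k: "koszul j i = koszul i j" by (simp add: koszul_def conj_commute)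
  note g = uea_gen_grade[OF xy(1)] uea_gen_grade[OF xy(2)]
  let ?X = "uea_gen x" and ?Y = "uea_gen y"
  have m: "(1 \<otimes> ?X) * (1 \<otimes> ?Y) = 1 \<otimes> (?X * ?Y)" "(1 \<otimes> ?Y) * (1 \<otimes> ?X) = 1 \<otimes> (?Y * ?X)"
    "(1 \<otimes> ?X) * (?Y \<otimes> 1) = koszul i j *\<^sub>C (?Y \<otimes> ?X)"
    "(1 \<otimes> ?Y) * (?X \<otimes> 1) = koszul i j *\<^sub>C (?X \<otimes> ?Y)"
    "(?X \<otimes> 1) * (1 \<otimes> ?Y) = ?X \<otimes> ?Y" "(?Y \<otimes> 1) * (1 \<otimes> ?X) = ?Y \<otimes> ?X"
    "(?X \<otimes> 1) * (?Y \<otimes> 1) = (?X * ?Y) \<otimes> 1" "(?Y \<otimes> 1) * (?X \<otimes> 1) = (?Y * ?X) \<otimes> 1"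
    using tensor_mult_hom[OF g(1) grade_one] tensor_mult_hom[OF g(2) grade_one]
      tensor_mult_hom[OF g(1) g(2)] tensor_mult_hom[OF g(2) g(1)]
      tensor_mult_hom[OF grade_one g(1)] tensor_mult_hom[OF grade_one g(2)]
      tensor_mult_hom[OF grade_one grade_one]
    by (simp_all add: k)
  note d = clinear_diff[OF clinear_tensor_left[OF clinear_id]]
    clinear_diff[OF clinear_tensor_right[OF clinear_id]]
  show "(1 \<otimes> ?X + ?X \<otimes> (1 :: 'g uea)) * (1 \<otimes> ?Y + ?Y \<otimes> 1) -
      koszul i j *\<^sub>C ((1 \<otimes> ?Y + ?Y \<otimes> 1) * (1 \<otimes> ?X + ?X \<otimes> 1)) =
      1 \<otimes> uea_gen (sbracket x y) + uea_gen (sbracket x y) \<otimes> 1"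
    unfolding br distrib_left distrib_right m d tensor_scale_left tensor_scale_right scaleC_distribs
    by (simp add: algebra_simps)
qed

lemma coproduct_one [simp]: "coproduct 1 = 1"
  and coproduct_mult: "coproduct (u * v) = coproduct u * coproduct v"
  and coproduct_gen: "coproduct (uea_gen x) = 1 \<otimes> uea_gen x + uea_gen x \<otimes> 1"
  and clinear_coproduct: "clinear coproduct"
  by (simp_all add: coproduct_def uea_lift_1 uea_lift_mult uea_lift_gen clinear_uea_lift
      enveloping_coproduct)

lemma counit_one [simp]: "counit 1 = 1"
  and counit_mult: "counit (u * v) = counit u * counit v"
  and counit_gen [simp]: "counit (uea_gen x) = 0"
  and clinear_counit: "clinear counit"
  by (simp_all add: counit_def uea_lift_1 uea_lift_mult uea_lift_gen clinear_uea_lift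
      enveloping_zero)

section \<open>The dual algebra\<close>

typedef (overloaded) 'g uea_dual = "{\<phi> :: 'g::lie_superalgebra uea \<Rightarrow> complex. clinear \<phi>}"
  morphisms dual_apply Abs_uea_dual
  by (rule exI[of _ "\<lambda>_. 0"]) (simp add: clinear_zero)

setup_lifting type_definition_uea_dual

lemma clinear_dual_apply: "clinear (dual_apply \<phi>)"
  using dual_apply[of \<phi>] by simp

lemma dual_eqI: "(\<And>u. dual_apply \<phi> u = dual_apply \<psi> u) \<Longrightarrow> \<phi> = \<psi>"
  by (simp add: dual_apply_inject[symmetric] fun_eq_iff)

instantiation uea_dual :: (lie_superalgebra) complex_vector
begin

lift_definition zero_uea_dual :: "'a uea_dual" is "\<lambda>_. 0" by (rule clinear_zero)
lift_definition plus_uea_dual :: "'a uea_dual \<Rightarrow> 'a uea_dual \<Rightarrow> 'a uea_dual"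
  is "\<lambda>\<phi> \<psi> u. \<phi> u + \<psi> u" by (rule clinear_plus)
lift_definition minus_uea_dual :: "'a uea_dual \<Rightarrow> 'a uea_dual \<Rightarrow> 'a uea_dual"
  is "\<lambda>\<phi> \<psi> u. \<phi> u - \<psi> u" by (rule clinear_minus2)
lift_definition uminus_uea_dual :: "'a uea_dual \<Rightarrow> 'a uea_dual"
  is "\<lambda>\<phi> u. - \<phi> u" by (simp add: clinear_iff)
lift_definition scaleC_uea_dual :: "complex \<Rightarrow> 'a uea_dual \<Rightarrow> 'a uea_dual"
  is "\<lambda>c \<phi> u. c *\<^sub>C \<phi> u" by (rule clinear_scaleC)

instance
  by standard (transfer, simp add: algebra_simps)+

end

lemmas dual_simps [simp] = zero_uea_dual.rep_eq plus_uea_dual.rep_eq minus_uea_dual.rep_eq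
  uminus_uea_dual.rep_eq scaleC_uea_dual.rep_eq

lift_definition dual_hcomp :: "bit \<Rightarrow> 'g::lie_superalgebra uea_dual \<Rightarrow> 'g uea_dual"
  is "\<lambda>i \<phi> u. \<phi> (hcomp i u)" by (rule clinear_compose) (auto intro: clinear_hcomp)

lemma dual_apply_hcomp_sum:
  "dual_apply \<phi> (hcomp 0 u) + dual_apply \<phi> (hcomp 1 u) = dual_apply \<phi> u"
  by (simp add: hcomp_sum flip: clinear_add[OF clinear_dual_apply])

text \<open>A functional is homogeneous of degree \<open>i\<close> if it vanishes on the elements of the other
  parity.\<close>

instantiation uea_dual :: (lie_superalgebra) superspace
begin

definition grade_uea_dual :: "bit \<Rightarrow> 'a uea_dual set"
  where "grade_uea_dual i = {\<phi>. \<forall>u\<in>grade (i + 1). dual_apply \<phi> u = 0}"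

instance
proof
  fix i and \<phi> \<psi> :: "'a uea_dual" and c
  show "0 \<in> (grade i :: 'a uea_dual set)"
    "\<phi> \<in> grade i \<Longrightarrow> \<psi> \<in> grade i \<Longrightarrow> \<phi> + \<psi> \<in> grade i"
    "\<phi> \<in> grade i \<Longrightarrow> c *\<^sub>C \<phi> \<in> grade i"
    by (simp_all add: grade_uea_dual_def)
  have "\<phi> = 0" if "\<phi> \<in> grade 0" "\<phi> \<in> grade 1" for \<phi> :: "'a uea_dual"
  proof (rule dual_eqI)
    fix u show "dual_apply \<phi> u = dual_apply 0 u"
      using that dual_apply_hcomp_sum[of \<phi> u] hcomp_grade[of 0 u] hcomp_grade[of 1 u]
      by (simp add: grade_uea_dual_def)
  qed
  then show "grade 0 \<inter> grade 1 = {0 :: 'a uea_dual}"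
    by (auto simp: grade_uea_dual_def)
  have "dual_hcomp i \<phi> \<in> grade i" for i
    by (cases i) (simp_all add: grade_uea_dual_def dual_hcomp.rep_eq hcomp_other
        clinear_0[OF clinear_dual_apply])
  moreover have "\<phi> = dual_hcomp 0 \<phi> + dual_hcomp 1 \<phi>"
    by (rule dual_eqI) (simp add: dual_hcomp.rep_eq dual_apply_hcomp_sum)
  ultimately show "\<exists>\<psi>\<in>grade 0. \<exists>\<chi>\<in>grade 1. \<phi> = \<psi> + \<chi>" by blast
qed

end

text \<open>\<open>\<phi> \<otimes> \<psi>\<close> as a functional on the tensor product, with the sign \<open>(-1)\<^sup>|\<^sup>a\<^sup>|\<^sup>|\<^sup>\<psi>\<^sup>|\<close> at \<open>a \<otimes> b\<close>
  for homogeneous \<open>a\<close> and \<open>\<psi>\<close>, extended bilinearly.\<close>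

definition dual_pairing ::
  "'g::lie_superalgebra uea_dual \<Rightarrow> 'g uea_dual \<Rightarrow> ('g uea, 'g uea) tensor \<Rightarrow> complex"
  where "dual_pairing \<phi> \<psi> = tensor_lift (\<lambda>a b.
    \<Sum>i\<in>{0, 1}. \<Sum>j\<in>{0, 1}. koszul i j * dual_apply \<phi> (hcomp i a) * dual_apply (hcomp j \<psi>) b)"

lemma cbilinear_dual_pairing: "cbilinear (\<lambda>a b.
    \<Sum>i\<in>{0, 1}. \<Sum>j\<in>{0, 1}. koszul i j * dual_apply \<phi> (hcomp i a) * dual_apply (hcomp j \<psi>) b)"
  unfolding cbilinear_def
  by (intro conjI allI clinear_sumf clinear_mult_left clinear_mult_right
      clinear_compose[OF clinear_dual_apply] clinear_hcomp clinear_id)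

lemma clinear_dual_pairing: "clinear (dual_pairing \<phi> \<psi>)"
  unfolding dual_pairing_def by (rule clinear_tensor_lift) (rule cbilinear_dual_pairing)

lemma dual_pairing_tensor: "dual_pairing \<phi> \<psi> (a \<otimes> b) =
    (\<Sum>i\<in>{0, 1}. \<Sum>j\<in>{0, 1}. koszul i j * dual_apply \<phi> (hcomp i a) * dual_apply (hcomp j \<psi>) b)"
  unfolding dual_pairing_def by (rule tensor_lift_tensor[OF cbilinear_dual_pairing])

lemma dual_pairing_hom: "a \<in> grade i \<Longrightarrow> \<psi> \<in> grade j \<Longrightarrow>
    dual_pairing \<phi> \<psi> (a \<otimes> b) = koszul i j * dual_apply \<phi> a * dual_apply \<psi> b"
  unfolding dual_pairing_tensor
  by (cases i; cases j) (simp_all add: hcomp_same hcomp_other clinear_0[OF clinear_dual_apply])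

lift_definition dual_lmul :: "'g::lie_superalgebra \<Rightarrow> 'g uea_dual \<Rightarrow> 'g uea_dual"
  is "\<lambda>x \<phi> u. \<phi> (uea_gen x * u)"
  by (rule clinear_compose) (auto intro: clinear_mult_left clinear_id)

lemma dual_lmul_grade: "x \<in> grade i \<Longrightarrow> \<psi> \<in> grade j \<Longrightarrow> dual_lmul x \<psi> \<in> grade (i + j)"
  using grade_mult[OF uea_gen_grade[of x i]]
  by (auto simp: grade_uea_dual_def dual_lmul.rep_eq add.assoc) (metis add.assoc bit_add_simps(2))

lemma clinear_dual_lmul: "clinear (dual_lmul x)"
  by (rule clinearI; rule dual_eqI) (simp_all add: dual_lmul.rep_eq)

lemma dual_pairing_lmul:
  assumes x: "x \<in> grade i" and psi: "\<psi> \<in> grade j"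
  shows "dual_pairing \<phi> \<psi> ((1 \<otimes> uea_gen x + uea_gen x \<otimes> 1) * t) =
    koszul i j * dual_pairing (dual_lmul x \<phi>) \<psi> t + dual_pairing \<phi> (dual_lmul x \<psi>) t"
proof (induction t rule: tensor_induct_hom)
  case (tensor a b p q)
  note g = uea_gen_grade[OF x]
  show ?case using tensor
    by (simp add: distrib_right tensor_mult_hom[OF g tensor(1)] tensor_mult_hom[OF grade_one tensor(1)]
        clinear_add[OF clinear_dual_pairing] clinear_scale[OF clinear_dual_pairing]
        dual_pairing_hom[OF tensor(1) psi] dual_pairing_hom[OF grade_mult[OF g tensor(1)] psi]
        dual_pairing_hom[OF tensor(1) dual_lmul_grade[OF x psi]] dual_lmul.rep_eq koszul_add)
      (cases i; cases j; cases p; simp)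
next
  case (add s t)
  then show ?case
    by (simp add: distrib_left[of "1 \<otimes> uea_gen x + uea_gen x \<otimes> 1"]
        clinear_add[OF clinear_dual_pairing])
      (simp add: algebra_simps)
qed

instantiation uea_dual :: (lie_superalgebra) "{one, times}"
begin

lift_definition one_uea_dual :: "'a uea_dual" is counit by (rule clinear_counit)

definition times_uea_dual :: "'a uea_dual \<Rightarrow> 'a uea_dual \<Rightarrow> 'a uea_dual"
  where "\<phi> * \<psi> = Abs_uea_dual (\<lambda>u. dual_pairing \<phi> \<psi> (coproduct u))"

instance ..

end

lemma dual_mult_apply: "dual_apply (\<phi> * \<psi>) u = dual_pairing \<phi> \<psi> (coproduct u)"
  unfolding times_uea_dual_def
  using clinear_compose[OF clinear_dual_pairing clinear_coproduct]
  by (subst Abs_uea_dual_inverse) simp_all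

lemma dual_mult_one: "dual_apply (\<phi> * \<psi>) 1 = dual_apply \<phi> 1 * dual_apply \<psi> 1"
proof -
  have "dual_apply (hcomp 0 \<psi>) 1 + dual_apply (hcomp 1 \<psi>) 1 = dual_apply \<psi> 1"
    by (metis hcomp_sum plus_uea_dual.rep_eq)
  then show ?thesis
    by (simp add: dual_mult_apply one_tensor_def dual_pairing_tensor hcomp_same[OF grade_one]
        hcomp_other[OF grade_one] clinear_0[OF clinear_dual_apply] flip: distrib_left)
qed

lemma dual_mult_gen:
  assumes "x \<in> grade i" "\<psi> \<in> grade j"
  shows "dual_apply (\<phi> * \<psi>) (uea_gen x * u) =
    koszul i j * dual_apply (dual_lmul x \<phi> * \<psi>) u + dual_apply (\<phi> * dual_lmul x \<psi>) u"
  by (simp add: dual_mult_apply coproduct_mult coproduct_gen dual_pairing_lmul[OF assms])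

lemma dual_lmul_mult:
  assumes "x \<in> grade i" "\<psi> \<in> grade j"
  shows "dual_lmul x (\<phi> * \<psi>) = koszul i j *\<^sub>C (dual_lmul x \<phi> * \<psi>) + \<phi> * dual_lmul x \<psi>"
  by (rule dual_eqI) (simp add: dual_lmul.rep_eq dual_mult_gen[OF assms])

lemma clinear_dual_mult: "clinear (\<lambda>\<phi>. \<phi> * \<psi>)" "clinear (\<lambda>\<psi>. \<phi> * \<psi>)"
  for \<phi> \<psi> :: "'g::lie_superalgebra uea_dual"
proof -
  have 1: "dual_pairing (\<phi> + \<phi>') \<psi> t = dual_pairing \<phi> \<psi> t + dual_pairing \<phi>' \<psi> t"
    "dual_pairing (c *\<^sub>C \<phi>) \<psi> t = c * dual_pairing \<phi> \<psi> t"
    "dual_pairing \<phi> (\<psi> + \<psi>') t = dual_pairing \<phi> \<psi> t + dual_pairing \<phi> \<psi>' t"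
    "dual_pairing \<phi> (c *\<^sub>C \<psi>) t = c * dual_pairing \<phi> \<psi> t"
    for \<phi> \<phi>' \<psi> \<psi>' :: "'g uea_dual" and t c
  proof (induction t rule: tensor_induct)
    case (tensor a b)
    note s = dual_pairing_tensor
    { case 1 show ?case by (simp add: s algebra_simps) }
    { case 2 show ?case by (simp add: s algebra_simps) }
    { case 3 show ?case by (simp add: s algebra_simps) }
    { case 4 show ?case by (simp add: s algebra_simps) }
  next
    case (add s t)
    note l = clinear_add[OF clinear_dual_pairing]
    { case 1 show ?case by (simp only: l add) (simp add: algebra_simps) }
    { case 2 show ?case by (simp only: l add) (simp add: algebra_simps) }
    { case 3 show ?case by (simp only: l add) (simp add: algebra_simps) }
    { case 4 show ?case by (simp only: l add) (simp add: algebra_simps) }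
  qed
  show "clinear (\<lambda>\<phi>. \<phi> * \<psi>)" "clinear (\<lambda>\<psi>. \<phi> * \<psi>)"
    by (rule clinearI; rule dual_eqI; simp add: dual_mult_apply 1)+
qed

lemma dual_mult_grade:
  fixes \<phi> \<psi> :: "'a::lie_superalgebra uea_dual"
  assumes "\<phi> \<in> grade i" "\<psi> \<in> grade j"
  shows "\<phi> * \<psi> \<in> grade (i + j)"
proof -
  have word: "dual_apply (\<phi> * \<psi>) (prod_list (map uea_gen xs)) = 0"
    if "list_all2 (\<lambda>x j. x \<in> grade j) xs js" "sum_list js = i + j + 1"
      "\<phi> \<in> grade i" "\<psi> \<in> grade j" for xs :: "'a list" and js i j \<phi> \<psi>
    using that
  proof (induction xs js arbitrary: i j \<phi> \<psi> rule: list_all2_induct)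
    case Nil
    then have "i + 1 = 0 \<or> j + 1 = 0" by (cases i; cases j) auto
    then have "dual_apply \<phi> 1 = 0 \<or> dual_apply \<psi> 1 = 0"
      using Nil grade_one[where 'a = "'a uea"] unfolding grade_uea_dual_def by fastforce
    then show ?case by (auto simp: dual_mult_one)
  next
    case (Cons x xs l js)
    have 1: "sum_list js = (l + i) + j + 1" "sum_list js = i + (l + j) + 1"
      using Cons.prems(1) by (cases l; cases i; cases j; cases "sum_list js"; simp)+
    show ?case
      using Cons.IH[OF 1(1) dual_lmul_grade[OF Cons.hyps(1) Cons.prems(2)] Cons.prems(3)]
        Cons.IH[OF 1(2) Cons.prems(2) dual_lmul_grade[OF Cons.hyps(1) Cons.prems(3)]]
      by (simp add: dual_mult_gen[OF Cons.hyps(1) Cons.prems(3)])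
  qed
  have "dual_apply (\<phi> * \<psi>) u = 0" if "u \<in> grade (i + j + 1)" for u
    using that unfolding grade_uea_def
  proof (induction rule: complex_vector.span_induct)
    case base
    show ?case by (rule csubspace_ker) (rule clinear_dual_apply)
  next
    case (step u)
    then show ?case using word[OF _ _ assms] unfolding hom_monomials_def by blast
  qed
  then show ?thesis by (simp add: grade_uea_dual_def)
qed

lemma dual_one_grade: "1 \<in> (grade 0 :: 'g::lie_superalgebra uea_dual set)"
proof -
  have "counit u = 0" if "u \<in> grade 1" for u :: "'g uea"
    using that unfolding grade_uea_def
  proof (induction rule: complex_vector.span_induct)
    case base
    show ?case by (rule csubspace_ker) (rule clinear_counit)
  next
    case (step u)
    then obtain xs js where *: "list_all2 (\<lambda>x j. x \<in> grade j) xs js" "sum_list js = 1"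
      "u = prod_list (map uea_gen xs)" unfolding hom_monomials_def by blast
    then have "xs \<noteq> []" by auto
    then show ?case using *(3) by (cases xs) (auto simp: counit_mult)
  qed
  then show ?thesis by (simp add: grade_uea_dual_def one_uea_dual.rep_eq)
qed

lemma dual_lmul_one: "dual_lmul x 1 = 0"
  by (rule dual_eqI) (simp add: dual_lmul.rep_eq one_uea_dual.rep_eq counit_mult)

lemma dual_mult_1_right: "\<phi> * 1 = \<phi>" for \<phi> :: "'g::lie_superalgebra uea_dual"
proof (rule dual_eqI)
  fix u show "dual_apply (\<phi> * 1) u = dual_apply \<phi> u"
  proof (induction u arbitrary: \<phi> rule: uea_induct)
    case (gen x i u)
    then show ?case
      by (simp add: dual_mult_gen[OF gen(1) dual_one_grade] dual_lmul_one
          clinear_0[OF clinear_dual_mult(2)] dual_lmul.rep_eq)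
  qed (simp_all add: dual_mult_one one_uea_dual.rep_eq clinear_add[OF clinear_dual_apply]
      clinear_scale[OF clinear_dual_apply])
qed

lemma dual_mult_1_left: "1 * \<phi> = \<phi>" for \<phi> :: "'g::lie_superalgebra uea_dual"
proof -
  have hom: "1 * \<phi> = \<phi>" if "\<phi> \<in> grade j" for \<phi> :: "'g uea_dual" and j
  proof (rule dual_eqI)
    fix u show "dual_apply (1 * \<phi>) u = dual_apply \<phi> u" using that
    proof (induction u arbitrary: j \<phi> rule: uea_induct)
      case (gen x i u)
      then show ?case
        using gen(2)[OF dual_lmul_grade[OF gen(1) gen(3)]]
        by (simp add: dual_mult_gen[OF gen(1) gen(3)] dual_lmul_one
            clinear_0[OF clinear_dual_mult(1)] dual_lmul.rep_eq)
    qed (auto simp add: dual_mult_one one_uea_dual.rep_eq clinear_add[OF clinear_dual_apply]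
        clinear_scale[OF clinear_dual_apply])
  qed
  have "1 * (hcomp 0 \<phi> + hcomp 1 \<phi>) = hcomp 0 \<phi> + hcomp 1 \<phi>"
    by (simp only: clinear_add[OF clinear_dual_mult(2)] hom[OF hcomp_grade])
  then show ?thesis by (simp only: hcomp_sum)
qed

lemma dual_mult_assoc: "\<phi> * \<psi> * \<chi> = \<phi> * (\<psi> * \<chi>)"
  for \<phi> \<psi> \<chi> :: "'g::lie_superalgebra uea_dual"
proof -
  note add = clinear_add[OF clinear_dual_mult(1)] clinear_add[OF clinear_dual_mult(2)]
  note scale = clinear_scale[OF clinear_dual_mult(1)] clinear_scale[OF clinear_dual_mult(2)]
  have hom: "\<phi> * \<psi> * \<chi> = \<phi> * (\<psi> * \<chi>)" if "\<psi> \<in> grade j" "\<chi> \<in> grade l"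
    for \<phi> \<psi> \<chi> :: "'g uea_dual" and j l
  proof (rule dual_eqI)
    fix u show "dual_apply (\<phi> * \<psi> * \<chi>) u = dual_apply (\<phi> * (\<psi> * \<chi>)) u" using that
    proof (induction u arbitrary: \<phi> \<psi> \<chi> j l rule: uea_induct)
      case (gen x i u)
      note psi = gen(3) and chi = gen(4) and x = gen(1)
      have "dual_apply (\<phi> * \<psi> * \<chi>) (uea_gen x * u) =
          koszul i l * koszul i j * dual_apply (dual_lmul x \<phi> * (\<psi> * \<chi>)) u
          + koszul i l * dual_apply (\<phi> * (dual_lmul x \<psi> * \<chi>)) u
          + dual_apply (\<phi> * (\<psi> * dual_lmul x \<chi>)) u"
        by (simp add: dual_mult_gen[OF x chi] dual_lmul_mult[OF x psi] add scale distrib_left mult.assoc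
            gen(2)[OF psi chi] gen(2)[OF dual_lmul_grade[OF x psi] chi]
            gen(2)[OF psi dual_lmul_grade[OF x chi]])
      also have "\<dots> = dual_apply (\<phi> * (\<psi> * \<chi>)) (uea_gen x * u)"
        by (simp add: dual_mult_gen[OF x dual_mult_grade[OF psi chi]] dual_lmul_mult[OF x chi]
            add scale koszul_add mult_ac)
      finally show ?case .
    qed (auto simp add: dual_mult_one clinear_add[OF clinear_dual_apply]
        clinear_scale[OF clinear_dual_apply])
  qed
  have "\<phi> * (hcomp 0 \<psi> + hcomp 1 \<psi>) * (hcomp 0 \<chi> + hcomp 1 \<chi>) =
      \<phi> * ((hcomp 0 \<psi> + hcomp 1 \<psi>) * (hcomp 0 \<chi> + hcomp 1 \<chi>))"
    by (simp only: add hom[OF hcomp_grade hcomp_grade])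
  then show ?thesis by (simp only: hcomp_sum)
qed

instance uea_dual :: (lie_superalgebra) superalgebra
proof
  fix a b c :: "'a uea_dual" and r :: complex and i j
  show "a * b * c = a * (b * c)" by (rule dual_mult_assoc)
  show "(a + b) * c = a * c + b * c" by (rule clinear_add[OF clinear_dual_mult(1)])
  show "a * (b + c) = a * b + a * c" by (rule clinear_add[OF clinear_dual_mult(2)])
  show "(r *\<^sub>C a) * b = r *\<^sub>C (a * b)" by (rule clinear_scale[OF clinear_dual_mult(1)])
  show "a * (r *\<^sub>C b) = r *\<^sub>C (a * b)" by (rule clinear_scale[OF clinear_dual_mult(2)])
  show "1 * a = a" by (rule dual_mult_1_left)
  show "a * 1 = a" by (rule dual_mult_1_right)
  have "dual_apply 0 1 \<noteq> dual_apply (1 :: 'a uea_dual) 1" by (simp add: one_uea_dual.rep_eq)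
  then show "(0 :: 'a uea_dual) \<noteq> 1" by metis
  show "1 \<in> (grade 0 :: 'a uea_dual set)" by (rule dual_one_grade)
  show "a \<in> grade i \<Longrightarrow> b \<in> grade j \<Longrightarrow> a * b \<in> grade (i + j)" by (rule dual_mult_grade)
qed

section \<open>Bi-invariant functionals\<close>

text \<open>The subspace \<open>\<kk>U(\<gg>) + U(\<gg>)\<kk>\<close>; products of subspaces are linear spans of products.\<close>

definition bi_ideal :: "'g::lie_superalgebra set \<Rightarrow> 'g uea set"
  where "bi_ideal k =
    {a + b | a b. a \<in> cspan {uea_gen x * u | x u. x \<in> k} \<and>
                  b \<in> cspan {u * uea_gen x | x u. x \<in> k}}"

definition bi_invariants :: "'g::lie_superalgebra set \<Rightarrow> 'g uea_dual set"
  where "bi_invariants k = {\<phi>. bi_ideal k \<subseteq> {u. dual_apply \<phi> u = 0}}"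

end

theory Submission
  imports Defs
begin

text \<open>
  A functional is \<open>\<kk>\<close>-bi-invariant iff it vanishes on all products \<open>x u\<close> and \<open>u x\<close> with
  \<open>x \<in> \<kk>\<close> and \<open>u \<in> U(\<gg>)\<close>. Because \<open>\<kk>\<close> is graded, it is enough to test homogeneous \<open>x\<close>
  (\<open>bi_invariantsI\<close>). This yields the grading: for homogeneous \<open>x\<close>, multiplication by \<open>x\<close>
  only shifts homogeneous components, so \<open>\<phi>\<^sub>i(x u) = \<phi>(x u\<^sub>j)\<close> for a suitable \<open>j\<close>, and the
  components of an invariant \<open>\<phi>\<close> are invariant (\<open>hcomp_bi_invariants\<close>).

  The product is invariant because elements of \<open>\<kk>\<close> are primitive: \<open>\<Delta>(x u)\<close> and
  \<open>\<Delta>(u x)\<close> are obtained from \<open>\<Delta>(u)\<close> by multiplying with \<open>1 \<otimes> x + x \<otimes> 1\<close> on the left or on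
  the right. In every resulting term one tensor factor contains \<open>x\<close> at its left or right end,
  so either \<open>\<phi>\<close> or \<open>\<psi>\<close> annihilates it and the Koszul signs do not matter
  (\<open>dual_mult_vanishes_left\<close>, \<open>dual_mult_vanishes_right\<close>). The unit is the counit, which is a
  character that vanishes on \<open>\<gg>\<close>.
\<close>

lemma uea_gen_hcomp: "uea_gen x = uea_gen (hcomp 0 x) + uea_gen (hcomp 1 x)"
  by (simp add: hcomp_sum flip: clinear_add[OF clinear_uea_gen])

lemma bi_invariants_iff:
  "\<phi> \<in> bi_invariants k \<longleftrightarrow>
    (\<forall>x\<in>k. \<forall>u. dual_apply \<phi> (uea_gen x * u) = 0 \<and> dual_apply \<phi> (u * uea_gen x) = 0)"
  (is "_ \<longleftrightarrow> ?R")
proof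
  let ?A = "{uea_gen x * u | x u. x \<in> k}" and ?B = "{u * uea_gen x | x u. x \<in> k}"
  have ideal: "bi_ideal k = {a + b | a b. a \<in> cspan ?A \<and> b \<in> cspan ?B}"
    by (simp add: bi_ideal_def)
  {
    assume inv: "\<phi> \<in> bi_invariants k"
    have "uea_gen x * u \<in> bi_ideal k" "u * uea_gen x \<in> bi_ideal k" if "x \<in> k" for x u
    proof -
      have "uea_gen x * u \<in> cspan ?A" "u * uea_gen x \<in> cspan ?B"
        using that by (blast intro: complex_vector.span_base)+
      then show "uea_gen x * u \<in> bi_ideal k" "u * uea_gen x \<in> bi_ideal k"
        using complex_vector.span_zero[of ?A] complex_vector.span_zero[of ?B]
        unfolding ideal by force+
    qed
    then show ?R using inv unfolding bi_invariants_def by blast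
  next
    assume ?R
    let ?K = "{u. dual_apply \<phi> u = 0}"
    have "csubspace ?K" by (rule csubspace_ker) (rule clinear_dual_apply)
    then have "cspan ?A \<subseteq> ?K" "cspan ?B \<subseteq> ?K"
      using \<open>?R\<close> by (intro complex_vector.span_minimal; blast)+
    then show "\<phi> \<in> bi_invariants k"
      unfolding bi_invariants_def ideal
      by (fastforce simp: clinear_add[OF clinear_dual_apply])
  }
qed

lemma bi_invariantsI:
  assumes k: "graded_subspace k"
    and left: "\<And>x i u. x \<in> k \<Longrightarrow> x \<in> grade i \<Longrightarrow> dual_apply \<phi> (uea_gen x * u) = 0"
    and right: "\<And>x i u. x \<in> k \<Longrightarrow> x \<in> grade i \<Longrightarrow> dual_apply \<phi> (u * uea_gen x) = 0"
  shows "\<phi> \<in> bi_invariants k"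
  unfolding bi_invariants_iff
proof (intro ballI allI conjI)
  fix x u assume "x \<in> k"
  then have hk: "hcomp i x \<in> k" for i using k by (simp add: graded_subspace_def)
  show "dual_apply \<phi> (uea_gen x * u) = 0" "dual_apply \<phi> (u * uea_gen x) = 0"
    using left[OF hk hcomp_grade] right[OF hk hcomp_grade]
    by (simp_all add: uea_gen_hcomp[of x] distrib_left distrib_right
        clinear_add[OF clinear_dual_apply])
qed

lemma csubspace_bi_invariants: "csubspace (bi_invariants k)"
  by (simp add: csubspace_def bi_invariants_iff)

lemma dual_apply_hcomp: "dual_apply (hcomp i \<phi>) u = dual_apply \<phi> (hcomp i u)"
proof -
  have grade: "dual_hcomp i \<phi> \<in> grade i" for i
    by (cases i) (simp_all add: grade_uea_dual_def dual_hcomp.rep_eq hcomp_other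
        clinear_0[OF clinear_dual_apply])
  have "\<phi> - dual_hcomp i \<phi> = dual_hcomp (i + 1) \<phi>"
  proof (rule dual_eqI)
    fix u
    show "dual_apply (\<phi> - dual_hcomp i \<phi>) u = dual_apply (dual_hcomp (i + 1) \<phi>) u"
      using dual_apply_hcomp_sum[of \<phi> u]
      by (cases i) (simp_all add: dual_hcomp.rep_eq algebra_simps)
  qed
  then have "hcomp i \<phi> = dual_hcomp i \<phi>"
    using grade by (intro hcomp_unique) simp_all
  then show ?thesis by (simp add: dual_hcomp.rep_eq)
qed

lemma hcomp_mult_hom_left:
  fixes a b :: "'a::superalgebra"
  assumes "a \<in> grade j"
  shows "hcomp i (a * b) = a * hcomp (j + i) b"
proof (rule hcomp_unique)
  show "a * hcomp (j + i) b \<in> grade i"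
    using grade_mult[OF assms hcomp_grade[of "j + i" b]] by simp
  show "a * b - a * hcomp (j + i) b \<in> grade (i + 1)"
    using grade_mult[OF assms hcomp_compl[of b "j + i"]]
    by (simp add: right_diff_distrib add.assoc)
qed

lemma hcomp_mult_hom_right:
  fixes a b :: "'a::superalgebra"
  assumes "b \<in> grade j"
  shows "hcomp i (a * b) = hcomp (j + i) a * b"
proof (rule hcomp_unique)
  show "hcomp (j + i) a * b \<in> grade i"
    using grade_mult[OF hcomp_grade[of "j + i" a] assms] by (simp add: add.commute)
  show "a * b - hcomp (j + i) a * b \<in> grade (i + 1)"
    using grade_mult[OF hcomp_compl[of a "j + i"] assms]
    by (simp add: left_diff_distrib add.assoc add.commute[of _ j])
qed

lemma hcomp_bi_invariants:
  assumes "graded_subspace k" "\<phi> \<in> bi_invariants k"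
  shows "hcomp i \<phi> \<in> bi_invariants k"
  using assms(2)
  by (intro bi_invariantsI[OF assms(1)])
    (simp_all add: bi_invariants_iff dual_apply_hcomp
      hcomp_mult_hom_left[OF uea_gen_grade] hcomp_mult_hom_right[OF uea_gen_grade])

lemma one_bi_invariants: "1 \<in> bi_invariants k"
  by (simp add: bi_invariants_iff one_uea_dual.rep_eq counit_mult)

text \<open>By \<open>dual_mult_gen\<close>, translation by \<open>x\<close> from the left, \<open>dual_lmul x\<close>, is a derivation of the
  dual algebra up to a sign, so if it kills both factors it kills their product. The sign depends
  on the parities of \<open>x\<close> and \<open>\<psi>\<close>, which are therefore homogeneous.\<close>

lemma dual_mult_vanishes_left:
  assumes "x \<in> grade i" "\<psi> \<in> grade j"
    and "\<And>u. dual_apply \<phi> (uea_gen x * u) = 0" "\<And>u. dual_apply \<psi> (uea_gen x * u) = 0"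
  shows "dual_apply (\<phi> * \<psi>) (uea_gen x * u) = 0"
proof -
  have "dual_lmul x \<phi> = 0" "dual_lmul x \<psi> = 0"
    by (rule dual_eqI; simp add: dual_lmul.rep_eq assms)+
  then show ?thesis by (simp add: dual_mult_gen[OF assms(1,2)])
qed

text \<open>Since \<open>\<Delta>(u x) = \<Delta>(u) (1 \<otimes> x + x \<otimes> 1)\<close>, it suffices that the pairing vanishes on
  \<open>t (1 \<otimes> x + x \<otimes> 1)\<close> for an arbitrary tensor \<open>t\<close>, which can be checked on homogeneous simple
  tensors.\<close>

lemma dual_mult_vanishes_right:
  assumes x: "x \<in> grade i" and \<psi>: "\<psi> \<in> grade j"
    and van: "\<And>u. dual_apply \<phi> (u * uea_gen x) = 0" "\<And>u. dual_apply \<psi> (u * uea_gen x) = 0"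
  shows "dual_apply (\<phi> * \<psi>) (u * uea_gen x) = 0"
proof -
  have "dual_pairing \<phi> \<psi> (t * (1 \<otimes> uea_gen x + uea_gen x \<otimes> 1)) = 0" for t
  proof (induction t rule: tensor_induct_hom)
    case (tensor a b p q)
    note g = uea_gen_grade[OF x]
    \<comment> \<open>Up to sign, the two terms are \<open>a \<otimes> b x\<close>, killed by \<open>\<psi>\<close>, and \<open>a x \<otimes> b\<close>, killed by \<open>\<phi>\<close>.\<close>
    show ?case using tensor
      by (simp add: distrib_left tensor_mult_hom[OF tensor(2) g]
          tensor_mult_hom[OF tensor(2) grade_one] clinear_add[OF clinear_dual_pairing]
          clinear_scale[OF clinear_dual_pairing] dual_pairing_hom[OF tensor(1) \<psi>]
          dual_pairing_hom[OF grade_mult[OF tensor(1) g] \<psi>] van)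
  next
    case (add s t)
    then show ?case by (simp add: distrib_right[of s t] clinear_add[OF clinear_dual_pairing])
  qed
  then show ?thesis by (simp add: dual_mult_apply coproduct_mult coproduct_gen)
qed

lemma mult_bi_invariants:
  assumes k: "graded_subspace k" and \<phi>: "\<phi> \<in> bi_invariants k" and \<psi>: "\<psi> \<in> bi_invariants k"
  shows "\<phi> * \<psi> \<in> bi_invariants k"
proof -
  have hom: "\<phi> * hcomp j \<psi> \<in> bi_invariants k" for j
    using \<phi> hcomp_bi_invariants[OF k \<psi>, of j]
    by (intro bi_invariantsI[OF k])
      (simp_all add: bi_invariants_iff dual_mult_vanishes_left[OF _ hcomp_grade]
        dual_mult_vanishes_right[OF _ hcomp_grade])
  have "\<phi> * \<psi> = \<phi> * hcomp 0 \<psi> + \<phi> * hcomp 1 \<psi>"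
    by (simp add: hcomp_sum flip: distrib_left)
  then show ?thesis
    using complex_vector.subspace_add[OF csubspace_bi_invariants hom hom] by simp
qed

theorem lemma2p2:
  fixes k :: "'g::lie_superalgebra set"
  assumes "lie_subsuperalgebra k"
  shows "graded_subspace (bi_invariants k) \<and> subalgebra (bi_invariants k)"
proof -
  have "graded_subspace k" using assms by (simp add: lie_subsuperalgebra_def)
  then show ?thesis
    unfolding graded_subspace_def[of "bi_invariants k"] subalgebra_def
    by (simp add: csubspace_bi_invariants hcomp_bi_invariants one_bi_invariants mult_bi_invariants)
qed

end
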